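(* Let $(W,S)$ be a Coxeter system with $S$ finite. The following partitions of $W$ are regular: (1) the cone type partition $\mathscr{T}$; (2) the Garside partition $\mathscr{G}_B$, for any Garside shadow $B$; (3) the $n$-Shi partition $\mathscr{S}_n$, for $n\in\mathbb{N}$.
   Context: $\ell$ is the length function, $D_L(w)=\{s\in S\mid\ell(sw)=\ell(w)-1\}$, and $x\preccurlyeq y$ means $\ell(x^{-1}y)=\ell(y)-\ell(x)$ (right weak order, for which every bounded subset $X$ has a least upper bound $\bigvee X$). An element $u$ is a suffix of $w$ if $\ell(w)=\ell(wu^{-1})+\ell(u)$. A partition $\mathscr{P}$ of $W$ is regular if: (1) $D_L$ is constant on each part $P$ (common value $D_L(P)$); and (2) if $P\in\mathscr{P}$ and $s\in S\setminus D_L(P)$ then $sP\subseteq P'$ for some part $P'\in\mathscr{P}$. Given a set $\mathbb{X}$ of subsets of $W$ with union $W$, the partition induced by $\mathbb{X}$ is the one in which $x,y$ lie in the same part iff $\{X\in\mathbb{X}\mid x\in X\}=\{X\in\mathbb{X}\mid y\in X\}$. Cone type partition: the cone type of $x$ is $T(x)=\{y\in W\mid\ell(xy)=\ell(x)+\ell(y)\}$, and $\mathscr{T}$ is the partition induced by the set of all cone types (equivalently, $x,y$ lie in the same part iff $T(x^{-1})=T(y^{-1})$). Garside partition: $B\subseteq W$ is a Garside shadow if $S\subseteq B$, $B$ contains $\bigvee X$ for each $X\subseteq B$ bounded in $(W,\preccurlyeq)$, and $B$ contains all suffixes of its elements. $\mathscr{G}_B$ is the partition induced by $\{C(b)\mid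 b\in B\}$, where $C(b)=\{v\in W\mid b\preccurlyeq v\}$. $n$-Shi partition: let $V$ be the real vector space with basis $\{\alpha_s\mid s\in S\}$ and form $\langle\alpha_s,\alpha_t\rangle=-\cos(\pi/m_{s,t})$ ($m_{s,t}$ the order of $st$; value $-1$ if $m_{s,t}=\infty$), $W$ acting by $s\lambda=\lambda-2\langle\lambda,\alpha_s\rangle\alpha_s$, $\Phi=\{w\alpha_s\}$, and $\Phi^+$ the roots that are non-negative combinations of the $\alpha_s$ ($\alpha<0$ means $-\alpha\in\Phi^+$). For $\beta=w\alpha_s$, $s_\beta=wsw^{-1}$; for $\beta\in\Phi^+$, $H_\beta^{+}=\{w\mid\ell(s_\beta w)>\ell(w)\}$ and $H_\beta^-=W\setminus H_\beta^+$. A root $\beta\in\Phi^+$ dominates $\alpha\in\Phi^+$ if for all $w\in W$, $w^{-1}\beta<0$ implies $w^{-1}\alpha<0$. $\mathcal{E}_n$ is the set of $\beta\in\Phi^+$ that dominate at most $n$ roots $\alpha\in\Phi^+\setminus\{\beta\}$. $\mathscr{S}_n$ is the partition induced by $\{H_\beta^+,H_\beta^-\mid\beta\in\mathcal{E}_n\}$. *)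

theory Defs
  imports
    Complex_Main
    "HOL-Library.Disjoint_Sets"
    "HOL-Algebra.Coset"
    "HOL-Algebra.Generated_Groups"
    "HOL-Algebra.Lattice"
    "HOL-Algebra.Multiplicative_Group"
begin

section \<open>Coxeter systems\<close>

locale group_with_subset = group W for W (structure) +
  fixes S :: "'a set"
  assumes S_subset: "S \<subseteq> carrier W"
begin

definition word_prod :: "'a list \<Rightarrow> 'a" where
  "word_prod xs = foldr (\<otimes>) xs \<one>"

text \<open>
  Deletion of one relator \<open>(s t)\<^sup>m\<close>, with \<open>m\<close> the order of \<open>s \<otimes> t\<close> in \<open>W\<close>. If \<open>s \<otimes> t\<close> has
  infinite order then \<^term>\<open>ord (s \<otimes> t) = 0\<close>, so the relator is empty and nothing is imposed.
\<close>
inductive relator_step :: "'a list \<Rightarrow> 'a list \<Rightarrow> bool" where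
  "\<lbrakk>us \<in> lists S; vs \<in> lists S; s \<in> S; t \<in> S\<rbrakk> \<Longrightarrow>
    relator_step (us @ concat (replicate (ord (s \<otimes> t)) [s, t]) @ vs) (us @ vs)"

end

text \<open>
  The axiom \<open>presentation\<close> says that \<open>W\<close> has the presentation with generators \<open>S\<close> and relations
  \<open>(s t)\<^sup>m = \<one>\<close>, for all \<open>s, t \<in> S\<close> such that \<open>s \<otimes> t\<close> has finite order \<open>m\<close>. Words in \<open>S\<close> without
  formal inverses suffice, because the relators \<open>s s\<close> (the case \<open>s = t\<close>) make each generator its
  own inverse.
\<close>
locale coxeter_system = group_with_subset +
  assumes generates: "generate W S = carrier W"
    and generator_order: "s \<in> S \<Longrightarrow> ord s = 2"
    and presentation: "\<lbrakk>xs \<in> lists S; ys \<in> lists S\<rbrakk> \<Longrightarrow>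
      word_prod xs = word_prod ys \<longleftrightarrow> equivclp relator_step xs ys"
begin

definition len :: "'a \<Rightarrow> nat" where
  "len w = (LEAST n. \<exists>xs \<in> lists S. length xs = n \<and> word_prod xs = w)"

definition left_descents :: "'a \<Rightarrow> 'a set" where
  "left_descents w = {s \<in> S. int (len (s \<otimes> w)) = int (len w) - 1}"

definition weak_order :: "'a gorder" where
  "weak_order = \<lparr>carrier = carrier W, eq = (=),
    le = (\<lambda>x y. int (len (inv x \<otimes> y)) = int (len y) - int (len x))\<rparr>"

definition suffix_of :: "'a \<Rightarrow> 'a \<Rightarrow> bool" where
  "suffix_of u w \<longleftrightarrow> len w = len (w \<otimes> inv u) + len u"


section \<open>Regular and induced partitions\<close>

text \<open>The set \<open>D\<close> below is the common value of the left descent sets of the elements of \<open>P\<close>.\<close>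
definition regular_partition :: "'a set set \<Rightarrow> bool" where
  "regular_partition \<P> \<longleftrightarrow>
    partition_on (carrier W) \<P> \<and>
    (\<forall>P\<in>\<P>. \<exists>D. (\<forall>x\<in>P. left_descents x = D) \<and>
      (\<forall>s\<in>S - D. \<exists>P'\<in>\<P>. s <# P \<subseteq> P'))"

definition induced_partition :: "'a set set \<Rightarrow> 'a set set" where
  "induced_partition \<X> = carrier W //
    {(x, y). x \<in> carrier W \<and> y \<in> carrier W \<and> {X \<in> \<X>. x \<in> X} = {X \<in> \<X>. y \<in> X}}"


section \<open>The cone type partition\<close>

definition cone_type :: "'a \<Rightarrow> 'a set" where
  "cone_type x = {y \<in> carrier W. len (x \<otimes> y) = len x + len y}"

definition cone_type_partition :: "'a set set" where
  "cone_type_partition = induced_partition (cone_type ` carrier W)"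


section \<open>Garside partitions\<close>

definition garside_shadow :: "'a set \<Rightarrow> bool" where
  "garside_shadow B \<longleftrightarrow>
    B \<subseteq> carrier W \<and> S \<subseteq> B \<and>
    (\<forall>X. X \<subseteq> B \<and> Upper weak_order X \<noteq> {} \<longrightarrow> \<Squnion>\<^bsub>weak_order\<^esub> X \<in> B) \<and>
    (\<forall>b\<in>B. \<forall>u\<in>carrier W. suffix_of u b \<longrightarrow> u \<in> B)"

definition cone :: "'a \<Rightarrow> 'a set" where
  "cone b = {v \<in> carrier W. b \<sqsubseteq>\<^bsub>weak_order\<^esub> v}"

definition garside_partition :: "'a set \<Rightarrow> 'a set set" where
  "garside_partition B = induced_partition (cone ` B)"


section \<open>Root system and \<open>n\<close>-Shi partitions\<close>

text \<open>
  For finite \<open>S\<close>, vectors of \<open>V\<close> are coefficient functions on the generators that vanish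
  outside \<open>S\<close>.
\<close>
definition simple_root :: "'a \<Rightarrow> 'a \<Rightarrow> real" where
  "simple_root s = (\<lambda>t. if t = s then 1 else 0)"

text \<open>Recall that \<^term>\<open>ord x = 0\<close> encodes infinite order.\<close>
definition coxeter_form :: "'a \<Rightarrow> 'a \<Rightarrow> real" where
  "coxeter_form s t =
    (if ord (s \<otimes> t) = 0 then - 1 else - cos (pi / real (ord (s \<otimes> t))))"

definition bilinear_form :: "('a \<Rightarrow> real) \<Rightarrow> ('a \<Rightarrow> real) \<Rightarrow> real" where
  "bilinear_form v w = (\<Sum>s\<in>S. \<Sum>t\<in>S. v s * w t * coxeter_form s t)"

definition simple_reflection :: "'a \<Rightarrow> ('a \<Rightarrow> real) \<Rightarrow> ('a \<Rightarrow> real)" where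
  "simple_reflection s v = (\<lambda>t. v t - 2 * bilinear_form v (simple_root s) * simple_root s t)"

text \<open>
  The simple reflections satisfy the defining relations of \<open>W\<close>, so they extend to an action of \<open>W\<close>
  on \<open>V\<close>: the choice of a word for \<open>w\<close> is immaterial.
\<close>
definition act :: "'a \<Rightarrow> ('a \<Rightarrow> real) \<Rightarrow> ('a \<Rightarrow> real)" where
  "act w = foldr simple_reflection (SOME xs. xs \<in> lists S \<and> word_prod xs = w)"

definition roots :: "('a \<Rightarrow> real) set" where
  "roots = {act w (simple_root s) | w s. w \<in> carrier W \<and> s \<in> S}"

definition positive_roots :: "('a \<Rightarrow> real) set" where
  "positive_roots = {\<beta> \<in> roots. \<forall>s\<in>S. \<beta> s \<ge> 0}"

definition negative :: "('a \<Rightarrow> real) \<Rightarrow> bool" where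
  "negative \<alpha> \<longleftrightarrow> (\<lambda>s. - \<alpha> s) \<in> positive_roots"

text \<open>The element \<open>w s w\<^sup>-\<^sup>1\<close> depends only on the root \<open>\<beta> = w \<alpha>\<^sub>s\<close>.\<close>
definition root_reflection :: "('a \<Rightarrow> real) \<Rightarrow> 'a" where
  "root_reflection \<beta> =
    (THE r. \<exists>w\<in>carrier W. \<exists>s\<in>S. \<beta> = act w (simple_root s) \<and> r = w \<otimes> s \<otimes> inv w)"

definition pos_halfspace :: "('a \<Rightarrow> real) \<Rightarrow> 'a set" where
  "pos_halfspace \<beta> = {w \<in> carrier W. len (root_reflection \<beta> \<otimes> w) > len w}"

definition neg_halfspace :: "('a \<Rightarrow> real) \<Rightarrow> 'a set" where
  "neg_halfspace \<beta> = carrier W - pos_halfspace \<beta>"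

definition dominates :: "('a \<Rightarrow> real) \<Rightarrow> ('a \<Rightarrow> real) \<Rightarrow> bool" where
  "dominates \<beta> \<alpha> \<longleftrightarrow>
    (\<forall>w\<in>carrier W. negative (act (inv w) \<beta>) \<longrightarrow> negative (act (inv w) \<alpha>))"

definition small_roots :: "nat \<Rightarrow> ('a \<Rightarrow> real) set" where
  "small_roots n = {\<beta> \<in> positive_roots.
    finite {\<alpha> \<in> positive_roots - {\<beta>}. dominates \<beta> \<alpha>} \<and>
    card {\<alpha> \<in> positive_roots - {\<beta>}. dominates \<beta> \<alpha>} \<le> n}"

definition shi_partition :: "nat \<Rightarrow> 'a set set" where
  "shi_partition n =
    induced_partition (pos_halfspace ` small_roots n \<union> neg_halfspace ` small_roots n)"

end

end

theory Submission
  imports Defs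
begin

text \<open>
  In all three cases the point is that, when \<open>s \<notin> D\<^sub>L(x)\<close>, membership of \<open>s x\<close> in a defining set
  is governed by membership of \<open>x\<close> in defining sets.
  For cone types, \<open>s x \<in> T(w)\<close> iff \<open>w < w s\<close> and \<open>x \<in> T(w s)\<close>.
  For a Garside shadow, \<open>b \<preccurlyeq> s x\<close> iff \<open>z = s \<or> b\<close> exists with \<open>z \<preccurlyeq> s x\<close>, and this amounts to \<open>s z \<preccurlyeq> x\<close>,
  where \<open>s z\<close> is a suffix of \<open>z\<close>.
  For \<open>n\<close>-small roots \<open>\<beta> \<noteq> \<alpha>\<^sub>s\<close>, the wall of \<open>\<beta>\<close> separates \<open>s x\<close> from \<open>1\<close> iff that of \<open>s \<beta>\<close> separates \<open>x\<close>
  from \<open>1\<close>; either \<open>s \<beta>\<close> is again \<open>n\<close>-small, or it dominates \<open>\<alpha>\<^sub>s\<close> and then does not separate at all.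

  The existence of joins and the root description of half-spaces rest on the fact that
  \<open>w \<alpha>\<^sub>s\<close> is positive iff \<open>w < w s\<close>, obtained from the presentation through the geometric
  representation and a reduction to dihedral groups.
\<close>

section \<open>Words and length\<close>

context coxeter_system
begin

declare in_lists_conv_set [simp] ball_Un [simp]

lemma gen_closed [simp]: "s \<in> S \<Longrightarrow> s \<in> carrier W"
  using S_subset by blast

lemma word_prod_Nil [simp]: "word_prod [] = \<one>"
  by (simp add: word_prod_def)

lemma word_prod_Cons [simp]: "word_prod (x # xs) = x \<otimes> word_prod xs"
  by (simp add: word_prod_def)

lemma word_prod_closed [simp]: "xs \<in> lists S \<Longrightarrow> word_prod xs \<in> carrier W"
  by (induction xs) auto

lemma word_prod_append:
  "xs \<in> lists S \<Longrightarrow> ys \<in> lists S \<Longrightarrow> word_prod (xs @ ys) = word_prod xs \<otimes> word_prod ys"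
  by (induction xs) (auto simp: m_assoc)

lemma gen_sq [simp]: "s \<in> S \<Longrightarrow> s \<otimes> s = \<one>"
  using pow_ord_eq_1[of s] generator_order[of s] by (simp add: numeral_2_eq_2)

lemma gen_inv [simp]: "s \<in> S \<Longrightarrow> inv s = s"
  by (simp add: inv_equality)

lemma gen_cancel [simp]: "s \<in> S \<Longrightarrow> w \<in> carrier W \<Longrightarrow> s \<otimes> (s \<otimes> w) = w"
  by (simp flip: m_assoc)

lemma gen_cancel_right [simp]: "s \<in> S \<Longrightarrow> w \<in> carrier W \<Longrightarrow> w \<otimes> s \<otimes> s = w"
  by (simp add: m_assoc)

lemma mult_inv_cancel [simp]:
  assumes "x \<in> carrier W" "y \<in> carrier W"
  shows "x \<otimes> (inv x \<otimes> y) = y" and "inv x \<otimes> (x \<otimes> y) = y"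
  using assms by (simp_all flip: m_assoc)

lemma word_prod_rev: "xs \<in> lists S \<Longrightarrow> word_prod (rev xs) = inv (word_prod xs)"
  by (induction xs) (auto simp: word_prod_append inv_mult_group)

lemma ex_word:
  assumes "w \<in> carrier W"
  shows "\<exists>xs\<in>lists S. word_prod xs = w"
proof -
  have "w \<in> generate W S"
    using assms generates by simp
  then show ?thesis
  proof induction
    case one
    show ?case by (rule bexI[of _ "[]"]) auto
  next
    case (incl h)
    then show ?case by (intro bexI[of _ "[h]"]) auto
  next
    case (inv h)
    then show ?case by (intro bexI[of _ "[h]"]) auto
  next
    case (eng h1 h2)
    then obtain xs ys where "xs \<in> lists S" "ys \<in> lists S" "word_prod xs = h1" "word_prod ys = h2"
      by blast
    then show ?case by (intro bexI[of _ "xs @ ys"]) (auto simp: word_prod_append)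
  qed
qed

lemma len_word_prod_le: "xs \<in> lists S \<Longrightarrow> len (word_prod xs) \<le> length xs"
  unfolding len_def by (rule Least_le) auto

lemma ex_reduced_word:
  assumes "w \<in> carrier W"
  obtains xs where "xs \<in> lists S" "length xs = len w" "word_prod xs = w"
proof -
  have "\<exists>xs\<in>lists S. length xs = len w \<and> word_prod xs = w"
    unfolding len_def by (rule LeastI_ex) (use ex_word[OF assms] in blast)
  then show thesis using that by blast
qed

lemma len_one [simp]: "len \<one> = 0"
  using len_word_prod_le[of "[]"] by simp

lemma len_mult_le:
  assumes "x \<in> carrier W" "y \<in> carrier W"
  shows "len (x \<otimes> y) \<le> len x + len y"
proof -
  obtain xs ys where "xs \<in> lists S" "length xs = len x" "word_prod xs = x"
     "ys \<in> lists S" "length ys = len y" "word_prod ys = y"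
    using assms by (metis ex_reduced_word)
  then show ?thesis using len_word_prod_le[of "xs @ ys"] by (simp add: word_prod_append)
qed

lemma len_inv [simp]:
  assumes "x \<in> carrier W"
  shows "len (inv x) = len x"
proof -
  have *: "len (inv y) \<le> len y" if y: "y \<in> carrier W" for y
  proof -
    obtain xs where "xs \<in> lists S" "length xs = len y" "word_prod xs = y"
      using y by (metis ex_reduced_word)
    then show ?thesis using len_word_prod_le[of "rev xs"] by (auto simp: word_prod_rev)
  qed
  show ?thesis using *[of x] *[of "inv x"] assms by simp
qed

section \<open>Consequences of the presentation: parity of the length\<close>

lemma relator_step_even_length: "relator_step xs ys \<Longrightarrow> even (length xs) \<longleftrightarrow> even (length ys)"
  by (auto elim!: relator_step.cases simp: length_concat sum_list_replicate)

text \<open>This is the form in which \<open>presentation\<close> enters: a function on words that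
  is invariant under deletion of relators descends to the group. It is applied to the parity of the
  word length and to the action of words on V.\<close>

lemma word_prod_eq_imp:
  assumes "xs \<in> lists S" "ys \<in> lists S" "word_prod xs = word_prod ys"
    and step: "\<And>us vs. relator_step us vs \<Longrightarrow> f us = f vs"
  shows "f xs = f ys"
proof -
  have "equivclp relator_step xs ys"
    using assms presentation by blast
  then show ?thesis
    by (induction rule: equivclp_induct) (auto dest: step)
qed

lemma even_len_word_prod:
  assumes "xs \<in> lists S"
  shows "even (len (word_prod xs)) \<longleftrightarrow> even (length xs)"
proof -
  obtain ys where ys: "ys \<in> lists S" "length ys = len (word_prod xs)" "word_prod ys = word_prod xs"
    using assms by (metis ex_reduced_word word_prod_closed)
  have "even (length ys) = even (length xs)"
    using word_prod_eq_imp[OF ys(1) assms ys(3), of "\<lambda>us. even (length us)"]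
      relator_step_even_length by blast
  then show ?thesis using ys by simp
qed

lemma even_len_mult:
  assumes "x \<in> carrier W" "y \<in> carrier W"
  shows "even (len (x \<otimes> y)) \<longleftrightarrow> (even (len x) \<longleftrightarrow> even (len y))"
proof -
  obtain xs ys where "xs \<in> lists S" "word_prod xs = x" "ys \<in> lists S" "word_prod ys = y"
    using assms by (metis ex_word)
  then show ?thesis
    using even_len_word_prod[of "xs @ ys"] even_len_word_prod[of xs] even_len_word_prod[of ys]
    by (auto simp: word_prod_append)
qed

lemma len_gen [simp]:
  assumes "s \<in> S"
  shows "len s = 1"
proof -
  have "len s \<le> 1" "odd (len s)"
    using len_word_prod_le[of "[s]"] even_len_word_prod[of "[s]"] assms by auto
  then show ?thesis by (cases "len s") auto
qed

text \<open>The triangle inequality bounds the difference of the lengths by one, and parity excludes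
  equality.\<close>

lemma len_gen_mult:
  assumes "s \<in> S" "w \<in> carrier W"
  shows "len (s \<otimes> w) = Suc (len w) \<or> len w = Suc (len (s \<otimes> w))"
proof -
  have "len (s \<otimes> w) \<le> Suc (len w)" "len w \<le> Suc (len (s \<otimes> w))"
    using assms len_mult_le[of s w] len_mult_le[of s "s \<otimes> w"] by auto
  moreover have "len (s \<otimes> w) \<noteq> len w"
    using even_len_mult[of s w] assms by auto
  ultimately show ?thesis by linarith
qed

lemma len_mult_gen:
  assumes "s \<in> S" "w \<in> carrier W"
  shows "len (w \<otimes> s) = Suc (len w) \<or> len w = Suc (len (w \<otimes> s))"
  using len_gen_mult[of s "inv w"] len_inv[of "w \<otimes> s"] assms
  by (simp add: inv_mult_group)

lemma ex_right_descent:
  assumes "w \<in> carrier W" "w \<noteq> \<one>"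
  obtains s where "s \<in> S" "len w = Suc (len (w \<otimes> s))"
proof -
  obtain xs where xs: "xs \<in> lists S" "length xs = len w" "word_prod xs = w"
    using assms by (metis ex_reduced_word)
  with assms obtain ys s where [simp]: "xs = ys @ [s]"
    by (cases xs rule: rev_cases) auto
  have "w \<otimes> s = word_prod ys" "s \<in> S" "ys \<in> lists S"
    using xs by (auto simp: word_prod_append)
  then have "len (w \<otimes> s) < len w"
    using len_word_prod_le[of ys] xs by auto
  with \<open>s \<in> S\<close> show thesis using that len_mult_gen[of s w] assms by fastforce
qed

lemma left_descents_iff:
  "s \<in> left_descents w \<longleftrightarrow> s \<in> S \<and> len w = Suc (len (s \<otimes> w))"
  unfolding left_descents_def by auto

lemma not_left_descent:
  "s \<in> S \<Longrightarrow> w \<in> carrier W \<Longrightarrow> s \<notin> left_descents w \<longleftrightarrow> len (s \<otimes> w) = Suc (len w)"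
  using len_gen_mult[of s w] unfolding left_descents_iff by linarith

section \<open>Induced partitions\<close>

text \<open>The part of \<open>s x\<close> serves as \<open>P'\<close> for the part of
  \<open>x\<close>. The hypotheses of \<open>mult\<close> are symmetric in \<open>x\<close> and
  \<open>y\<close> apart from the last one, so one implication suffices: exchanging the two elements
  gives the converse.\<close>

lemma regular_induced_partition:
  assumes descents: "\<And>x y. \<lbrakk>x \<in> carrier W; y \<in> carrier W; \<forall>X\<in>\<X>. x \<in> X \<longleftrightarrow> y \<in> X\<rbrakk>
      \<Longrightarrow> left_descents x = left_descents y"
    and mult: "\<And>s x y X. \<lbrakk>s \<in> S; x \<in> carrier W; y \<in> carrier W; \<forall>X\<in>\<X>. x \<in> X \<longleftrightarrow> y \<in> X;
        len (s \<otimes> x) = Suc (len x); len (s \<otimes> y) = Suc (len y); X \<in> \<X>; s \<otimes> x \<in> X\<rbrakk>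
      \<Longrightarrow> s \<otimes> y \<in> X"
  shows "regular_partition (induced_partition \<X>)"
proof -
  define r where "r = {(x, y). x \<in> carrier W \<and> y \<in> carrier W \<and> (\<forall>X\<in>\<X>. x \<in> X \<longleftrightarrow> y \<in> X)}"
  have ind: "induced_partition \<X> = carrier W // r"
    unfolding induced_partition_def r_def by (rule arg_cong[where f = "(//) (carrier W)"]) blast
  have eq: "equiv (carrier W) r"
    unfolding r_def by (rule equivI) (auto simp: refl_on_def sym_def trans_def)
  have "\<exists>D. (\<forall>x\<in>P. left_descents x = D) \<and> (\<forall>s\<in>S - D. \<exists>P'\<in>carrier W // r. s <# P \<subseteq> P')"
    if quot: "P \<in> carrier W // r" for P
  proof -
    obtain x where x: "x \<in> carrier W" and P: "P = r `` {x}"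
      using quot by (rule quotientE)
    have D: "left_descents y = left_descents x" if "y \<in> P" for y
      using that descents[of x y] unfolding P r_def by auto
    have "s <# P \<subseteq> r `` {s \<otimes> x}" if s: "s \<in> S" "s \<notin> left_descents x" for s
    proof -
      have "(s \<otimes> x, s \<otimes> y) \<in> r" if y: "(x, y) \<in> r" for y
      proof -
        have y: "y \<in> carrier W" "\<forall>X\<in>\<X>. x \<in> X \<longleftrightarrow> y \<in> X" "left_descents y = left_descents x"
          using y D[of y] unfolding P r_def by simp_all
        then have "len (s \<otimes> x) = Suc (len x)" "len (s \<otimes> y) = Suc (len y)"
          using s x not_left_descent[of s x] not_left_descent[of s y] by simp_all
        then have "s \<otimes> x \<in> X \<longleftrightarrow> s \<otimes> y \<in> X" if "X \<in> \<X>" for X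
          using mult[of s x y X] mult[of s y x X] s x y(1,2) that by blast
        then show ?thesis
          using s x y(1) unfolding r_def by simp
      qed
      then show ?thesis unfolding l_coset_def P by blast
    qed
    moreover have "r `` {s \<otimes> x} \<in> carrier W // r" if "s \<in> S" for s
      using that x by (intro quotientI) auto
    ultimately show ?thesis using D by blast
  qed
  then show ?thesis
    unfolding regular_partition_def ind using partition_on_quotient[OF eq] by blast
qed

section \<open>Cone types\<close>

text \<open>Since w(sx) = (ws)x, both sides give the same length equation when ws is longer than w.
  When ws is shorter, w(sx) has length at most len w - 1 + len x, too small for membership.\<close>

lemma gen_mult_mem_cone_type:
  assumes "s \<in> S" "x \<in> carrier W" "w \<in> carrier W" "len (s \<otimes> x) = Suc (len x)"
  shows "s \<otimes> x \<in> cone_type w \<longleftrightarrow> len (w \<otimes> s) = Suc (len w) \<and> x \<in> cone_type (w \<otimes> s)"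
proof -
  have "w \<otimes> (s \<otimes> x) = w \<otimes> s \<otimes> x"
    using assms by (simp add: m_assoc)
  moreover have "len (w \<otimes> s \<otimes> x) < len w + len (s \<otimes> x)" if "len (w \<otimes> s) \<noteq> Suc (len w)"
    using len_mult_le[of "w \<otimes> s" x] len_mult_gen[OF assms(1,3)] assms that by force
  ultimately show ?thesis
    using assms unfolding cone_type_def by (cases "len (w \<otimes> s) = Suc (len w)") simp_all
qed

lemma regular_cone_type_partition: "regular_partition cone_type_partition"
  unfolding cone_type_partition_def
proof (rule regular_induced_partition)
  fix x y
  assume x: "x \<in> carrier W" "y \<in> carrier W"
    and same: "\<forall>X\<in>cone_type ` carrier W. x \<in> X \<longleftrightarrow> y \<in> X"
  \<comment> \<open>The cone types of the generators record the left descents.\<close>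
  have *: "s \<notin> left_descents z \<longleftrightarrow> z \<in> cone_type s" if "s \<in> S" "z \<in> carrier W" for s z
    using that not_left_descent[of s z] unfolding cone_type_def by simp
  have "s \<in> left_descents x \<longleftrightarrow> s \<in> left_descents y" if "s \<in> S" for s
  proof -
    have "x \<in> cone_type s \<longleftrightarrow> y \<in> cone_type s" using same that by simp
    then show ?thesis using *[OF that x(1)] *[OF that x(2)] by blast
  qed
  then show "left_descents x = left_descents y"
    unfolding left_descents_def by blast
next
  fix s x y X
  assume s: "s \<in> S" "x \<in> carrier W" "y \<in> carrier W"
    and same: "\<forall>X\<in>cone_type ` carrier W. x \<in> X \<longleftrightarrow> y \<in> X"
    and len: "len (s \<otimes> x) = Suc (len x)" "len (s \<otimes> y) = Suc (len y)"
    and X: "X \<in> cone_type ` carrier W" "s \<otimes> x \<in> X"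
  then obtain w where w: "w \<in> carrier W" "X = cone_type w" by auto
  have "w \<otimes> s \<in> carrier W" using s w by simp
  moreover have "len (w \<otimes> s) = Suc (len w)" "x \<in> cone_type (w \<otimes> s)"
    using gen_mult_mem_cone_type[OF s(1,2) w(1) len(1)] X w by simp_all
  ultimately show "s \<otimes> y \<in> X"
    using gen_mult_mem_cone_type[OF s(1,3) w(1) len(2)] same w by blast
qed

end

section \<open>The geometric representation\<close>

text \<open>Finiteness gives the double sum in \<open>bilinear_form\<close> its intended value,
  because \<open>sum\<close> over an infinite set is 0.\<close>

locale finite_coxeter_system = coxeter_system +
  assumes finite_S: "finite S"
begin

lemma ord_gen_mult_commute:
  assumes "s \<in> S" "t \<in> S"
  shows "ord (s \<otimes> t) = ord (t \<otimes> s)"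
proof -
  have "t \<otimes> s = inv (s \<otimes> t)"
    using assms by (simp add: inv_mult_group)
  then show ?thesis using assms by (simp add: ord_inv)
qed

lemma coxeter_form_commute: "s \<in> S \<Longrightarrow> t \<in> S \<Longrightarrow> coxeter_form s t = coxeter_form t s"
  using ord_gen_mult_commute unfolding coxeter_form_def by metis

lemma coxeter_form_self [simp]: "s \<in> S \<Longrightarrow> coxeter_form s s = 1"
  unfolding coxeter_form_def by simp

lemma bilinear_form_linear_left:
  "bilinear_form (\<lambda>x. a * v x + b * w x) u = a * bilinear_form v u + b * bilinear_form w u"
  unfolding bilinear_form_def by (simp add: sum.distrib sum_distrib_left algebra_simps)

lemma bilinear_form_linear_right:
  "bilinear_form u (\<lambda>x. a * v x + b * w x) = a * bilinear_form u v + b * bilinear_form u w"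
  unfolding bilinear_form_def by (simp add: sum.distrib sum_distrib_left algebra_simps)

lemma bilinear_form_commute: "bilinear_form v w = bilinear_form w v"
  unfolding bilinear_form_def
  by (subst sum.swap) (auto intro!: sum.cong simp: coxeter_form_commute)

lemma bilinear_form_simple_roots [simp]:
  assumes "s \<in> S" "t \<in> S"
  shows "bilinear_form (simple_root s) (simple_root t) = coxeter_form s t"
proof -
  have "bilinear_form (simple_root s) (simple_root t) =
      (\<Sum>x\<in>S. if x = s then \<Sum>y\<in>S. if y = t then coxeter_form x y else 0 else 0)"
    unfolding bilinear_form_def simple_root_def by (intro sum.cong) (auto intro!: sum.cong)
  then show ?thesis using assms finite_S by simp
qed

lemma simple_reflection_alt:
  "simple_reflection s v =
    (\<lambda>x. 1 * v x + (- 2 * bilinear_form v (simple_root s)) * simple_root s x)"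
  unfolding simple_reflection_def by auto

lemma simple_reflection_linear:
  "simple_reflection s (\<lambda>x. a * v x + b * w x) =
    (\<lambda>x. a * simple_reflection s v x + b * simple_reflection s w x)"
  unfolding simple_reflection_def bilinear_form_linear_left by (auto simp: algebra_simps)

lemma bilinear_form_reflection:
  assumes "s \<in> S"
  shows "bilinear_form (simple_reflection s v) (simple_reflection s w) = bilinear_form v w"
  unfolding simple_reflection_alt bilinear_form_linear_left bilinear_form_linear_right
  using assms bilinear_form_commute[of "simple_root s" w] by (simp add: algebra_simps)

lemma simple_reflection_involution [simp]:
  assumes "s \<in> S"
  shows "simple_reflection s (simple_reflection s v) = v"
  unfolding simple_reflection_alt bilinear_form_linear_left using assms by auto

section \<open>The action of words on V, and alternating words in two generators\<close>

abbreviation word_act :: "'a list \<Rightarrow> ('a \<Rightarrow> real) \<Rightarrow> 'a \<Rightarrow> real" where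
  "word_act \<equiv> foldr simple_reflection"

lemma word_act_linear:
  "word_act xs (\<lambda>x. a * v x + b * w x) = (\<lambda>x. a * word_act xs v x + b * word_act xs w x)"
  by (induction xs) (auto simp: simple_reflection_linear)

lemma bilinear_form_word_act:
  "xs \<in> lists S \<Longrightarrow> bilinear_form (word_act xs v) (word_act xs w) = bilinear_form v w"
  by (induction xs) (auto simp: bilinear_form_reflection)

text \<open>The last letter is \<open>t\<close>, so the first one depends on the parity of \<open>k\<close>.\<close>
primrec alt_word :: "'a \<Rightarrow> 'a \<Rightarrow> nat \<Rightarrow> 'a list" where
  "alt_word s t 0 = []"
| "alt_word s t (Suc k) = (if even k then t else s) # alt_word s t k"

lemma alt_word_in_lists: "s \<in> S \<Longrightarrow> t \<in> S \<Longrightarrow> alt_word s t k \<in> lists S"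
  by (induction k) auto

lemma length_alt_word [simp]: "length (alt_word s t k) = k"
  by (induction k) auto

lemma alt_word_even: "alt_word s t (2 * k) = concat (replicate k [s, t])"
  by (induction k) auto

lemma alt_word_split:
  assumes "s \<in> S" "t \<in> S" "m \<le> k"
  shows "\<exists>us\<in>lists S. length us = k - m \<and> alt_word s t k = us @ alt_word s t m"
  using assms(3)
proof (induction k rule: dec_induct)
  case base
  show ?case by (rule bexI[of _ "[]"]) auto
next
  case (step k)
  then obtain us where "us \<in> lists S" "length us = k - m" "alt_word s t k = us @ alt_word s t m"
    by blast
  then show ?case using assms(1,2) step.hyps
    by (intro bexI[of _ "(if even k then t else s) # us"]) auto
qed

lemma word_prod_alt_word_even:
  assumes "s \<in> S" "t \<in> S"
  shows "word_prod (alt_word s t (2 * k)) = (s \<otimes> t) [^] k"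
proof (induction k)
  case (Suc k)
  have "word_prod (alt_word s t (2 * Suc k)) = (s \<otimes> t) \<otimes> (s \<otimes> t) [^] k"
    using assms Suc by (simp add: m_assoc)
  also have "\<dots> = (s \<otimes> t) [^] Suc k"
    using assms nat_pow_Suc2[of "s \<otimes> t" k] by simp
  finally show ?case .
qed auto

text \<open>The braid relation. For m = 2k the square of (st)^k is 1, so (st)^k equals its inverse
  (ts)^k. For m = 2k + 1 the inverse of (st)^k is (st)^(k+1), and multiplying by s on the left gives
  s(ts)^k = t(st)^k. For infinite order both words are empty.\<close>

lemma word_prod_alt_word_ord:
  assumes s: "s \<in> S" "t \<in> S"
  shows "word_prod (alt_word s t (ord (s \<otimes> t))) = word_prod (alt_word t s (ord (s \<otimes> t)))"
proof -
  let ?p = "s \<otimes> t" and ?m = "ord (s \<otimes> t)"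
  have p: "?p \<in> carrier W" using s by simp
  have inv: "(t \<otimes> s) [^] k = inv (?p [^] k)" for k :: nat
  proof -
    have "t \<otimes> s = inv ?p" using s by (simp add: inv_mult_group)
    then show ?thesis using p by (simp add: nat_pow_inv)
  qed
  have one: "?p [^] ?m = \<one>" using p by (rule pow_ord_eq_1)
  show ?thesis
  proof (cases "even ?m")
    case True
    then obtain k where k: "?m = 2 * k" by blast
    have "?p [^] k \<otimes> ?p [^] k = \<one>"
      using one p unfolding k mult_2 by (simp add: nat_pow_mult)
    then have "inv (?p [^] k) = ?p [^] k" using p by (simp add: inv_equality)
    then show ?thesis using s inv unfolding k by (simp only: word_prod_alt_word_even)
  next
    case False
    then obtain k where k: "?m = Suc (2 * k)" by (metis oddE Suc_eq_plus1)
    have "?p [^] Suc k \<otimes> ?p [^] k = ?p [^] (Suc k + k)"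
      using p by (rule nat_pow_mult)
    also have "\<dots> = \<one>" using one unfolding k by (simp only: mult_2 add_Suc)
    finally have "?p [^] Suc k \<otimes> ?p [^] k = \<one>" .
    then have "inv (?p [^] k) = ?p [^] Suc k" using p by (intro inv_equality) auto
    also have "\<dots> = s \<otimes> t \<otimes> ?p [^] k" using nat_pow_Suc2[OF p] .
    finally have "s \<otimes> inv (?p [^] k) = t \<otimes> ?p [^] k" using s by (simp add: m_assoc)
    then show ?thesis using s inv unfolding k
      by (simp add: word_prod_alt_word_even del: mult_Suc_right)
  qed
qed

text \<open>Chebyshev polynomials of the second kind with the index shifted: \<open>cheb c n\<close>
  is U_(n-1)(c), or sin(nx)/sin(x) at c = cos x. The polynomial recursion also covers c = 1, the
  case of infinite order, where that quotient is undefined.\<close>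

fun cheb :: "real \<Rightarrow> nat \<Rightarrow> real" where
  "cheb c 0 = 0"
| "cheb c (Suc 0) = 1"
| "cheb c (Suc (Suc n)) = 2 * c * cheb c (Suc n) - cheb c n"

lemma cheb_cos: "cheb (cos x) n * sin x = sin (real n * x)"
proof (induction "cos x" n rule: cheb.induct)
  case (3 n)
  have "sin (real (Suc (Suc n)) * x) = sin (real (Suc n) * x + x)"
    "sin (real n * x) = sin (real (Suc n) * x - x)"
    by (simp_all add: algebra_simps)
  then have "sin (real (Suc (Suc n)) * x) + sin (real n * x) = 2 * cos x * sin (real (Suc n) * x)"
    by (simp only: sin_add sin_diff) (simp add: algebra_simps)
  then show ?case using 3 by (simp add: algebra_simps)
qed auto

lemma cheb_one: "cheb 1 n = real n"
  by (induction "1::real" n rule: cheb.induct) auto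

text \<open>Each further letter changes only one of the two coefficients, replacing a by 2cb - a,
  where b is the other one. This is the recursion of \<open>cheb\<close>; the parity of k decides
  which coefficient is the newer one.\<close>

lemma word_act_alt_word:
  assumes "s \<in> S" "t \<in> S" "c = - coxeter_form s t"
  shows "word_act (alt_word s t k) (simple_root s) =
    (\<lambda>x. (if even k then cheb c (Suc k) else cheb c k) * simple_root s x
       + (if even k then cheb c k else cheb c (Suc k)) * simple_root t x)"
proof (induction k)
  case (Suc k)
  have B: "bilinear_form (simple_root s) (simple_root t) = - c"
    "bilinear_form (simple_root t) (simple_root s) = - c"
    "bilinear_form (simple_root s) (simple_root s) = 1"
    "bilinear_form (simple_root t) (simple_root t) = 1"
    using assms coxeter_form_commute[of s t] by auto
  show ?case
    by (cases "even k")
      (simp_all add: Suc, simp_all add: simple_reflection_def bilinear_form_linear_left B,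
        simp_all add: algebra_simps)
qed auto

lemma ord_gen_mult_ge_2:
  assumes "s \<in> S" "t \<in> S" "s \<noteq> t" "ord (s \<otimes> t) \<noteq> 0"
  shows "ord (s \<otimes> t) \<ge> 2"
proof -
  have "s \<otimes> t \<noteq> \<one>"
    using assms by (metis gen_closed gen_inv inv_equality)
  then have "ord (s \<otimes> t) \<noteq> 1" using assms ord_eq_1[of "s \<otimes> t"] by simp
  then show ?thesis using assms by linarith
qed

text \<open>For distinct s, t and finite m, the product st acts on the plane of the two simple roots
  as a rotation by 2 pi / m, so its m-th power fixes that plane. It also fixes the orthogonal
  complement, and the two together span V. If s = t, a reflection is squared; for infinite order the
  relator is empty.\<close>

lemma word_act_relator:
  assumes s: "s \<in> S" "t \<in> S"
  shows "word_act (concat (replicate (ord (s \<otimes> t)) [s, t])) v = v"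
proof (cases "s = t \<or> ord (s \<otimes> t) = 0")
  case True
  then show ?thesis using s by auto
next
  case False
  define m where "m = ord (s \<otimes> t)"
  define \<theta> where "\<theta> = pi / real m"
  have m: "m \<ge> 2" using False s ord_gen_mult_ge_2 unfolding m_def by blast
  then have sin: "sin \<theta> > 0" unfolding \<theta>_def by (intro sin_gt_zero) (auto simp: field_simps)
  have m\<theta>: "real m * \<theta> = pi" using m unfolding \<theta>_def by simp
  have fixed: "word_act (concat (replicate m [p, q])) (simple_root p) = simple_root p"
    if pq: "p \<in> S" "q \<in> S" "coxeter_form p q = - cos \<theta>" for p q
  proof -
    have e: "real (2 * m) * \<theta> = 2 * pi" "real (Suc (2 * m)) * \<theta> = \<theta> + 2 * pi"
      using m\<theta> by (simp_all add: algebra_simps)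
    have "cheb (cos \<theta>) (2 * m) * sin \<theta> = 0"
      unfolding cheb_cos e by simp
    moreover have "cheb (cos \<theta>) (Suc (2 * m)) * sin \<theta> = sin \<theta>"
      unfolding cheb_cos e by (rule sin_periodic)
    ultimately show ?thesis
      using word_act_alt_word[OF pq(1,2), of "cos \<theta>" "2 * m"] pq sin
      by (simp flip: alt_word_even)
  qed
  have form: "coxeter_form s t = - cos \<theta>" "coxeter_form t s = - cos \<theta>"
    using False s coxeter_form_commute[of s t] unfolding coxeter_form_def \<theta>_def m_def by auto
  have fs: "word_act (concat (replicate m [s, t])) (simple_root s) = simple_root s"
    using fixed s form by blast
  \<comment> \<open>\<open>fixed\<close> with the generators exchanged shows that (ts)^m fixes
    \<open>\<alpha>\<^sub>t\<close>. Since (st)^m undoes (ts)^m, it fixes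
    \<open>\<alpha>\<^sub>t\<close> as well.\<close>
  have cancel: "word_act (concat (replicate n [s, t])) (word_act (concat (replicate n [t, s])) u) = u"
    for n u
  proof (induction n arbitrary: u)
    case (Suc n)
    have "concat (replicate (Suc n) [t, s]) = concat (replicate n [t, s]) @ [t, s]"
      by (simp flip: replicate_append_same)
    moreover have "concat (replicate (Suc n) [s, t]) = [s, t] @ concat (replicate n [s, t])"
      by simp
    ultimately show ?case using Suc s by simp
  qed auto
  have ft: "word_act (concat (replicate m [s, t])) (simple_root t) = simple_root t"
    using cancel[of m "simple_root t"] fixed[of t s] s form by simp
  define c where "c = cos \<theta>"
  have c: "1 - c\<^sup>2 \<noteq> 0"
    using sin sin_squared_eq[of \<theta>] unfolding c_def
    by (metis less_irrefl zero_eq_power2)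
  \<comment> \<open>Subtract from \<open>v\<close> its orthogonal projection to the plane spanned by the two simple roots,
    on which the form is positive definite.\<close>
  define x where "x = bilinear_form v (simple_root s)"
  define y where "y = bilinear_form v (simple_root t)"
  \<comment> \<open>Cramer's rule for the Gram matrix of the two simple roots, which has diagonal
    entries 1, off-diagonal entries -c and determinant 1 - c^2.\<close>
  define a where "a = (x + c * y) / (1 - c\<^sup>2)"
  define b where "b = (y + c * x) / (1 - c\<^sup>2)"
  have ab: "a - c * b = x" "b - c * a = y"
  proof -
    have "a * (1 - c\<^sup>2) = x + c * y" "b * (1 - c\<^sup>2) = y + c * x"
      using c unfolding a_def b_def by simp_all
    moreover have "(a - c * b) * (1 - c\<^sup>2) = a * (1 - c\<^sup>2) - c * (b * (1 - c\<^sup>2))"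
      "(b - c * a) * (1 - c\<^sup>2) = b * (1 - c\<^sup>2) - c * (a * (1 - c\<^sup>2))"
      by (simp_all add: algebra_simps)
    ultimately have "(a - c * b) * (1 - c\<^sup>2) = x * (1 - c\<^sup>2)"
      "(b - c * a) * (1 - c\<^sup>2) = y * (1 - c\<^sup>2)"
      by (simp_all only:) (simp_all add: algebra_simps power2_eq_square)
    then show "a - c * b = x" "b - c * a = y" using c by simp_all
  qed
  define p where "p = (\<lambda>z. a * simple_root s z + b * simple_root t z)"
  define u where "u = (\<lambda>z. 1 * v z + (- 1) * p z)"
  have "bilinear_form u (simple_root s) = 0" "bilinear_form u (simple_root t) = 0"
    unfolding u_def bilinear_form_linear_left p_def using s form ab
    by (auto simp flip: x_def y_def c_def)
  then have "simple_reflection s u = u" "simple_reflection t u = u"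
    unfolding simple_reflection_def by auto
  then have fu: "word_act (concat (replicate n [s, t])) u = u" for n
    by (induction n) auto
  have fp: "word_act (concat (replicate m [s, t])) p = p"
    unfolding p_def word_act_linear fs ft ..
  have v: "v = (\<lambda>z. 1 * u z + 1 * p z)" unfolding u_def by auto
  have "word_act (concat (replicate m [s, t])) v = v"
    by (subst (1 2) v) (simp only: word_act_linear fu fp)
  then show ?thesis unfolding m_def .
qed

lemma word_act_relator_step: "relator_step xs ys \<Longrightarrow> word_act xs = word_act ys"
  by (auto elim!: relator_step.cases simp: word_act_relator fun_eq_iff)

text \<open>Relators act trivially, so the word chosen by \<open>SOME\<close> in \<open>act\<close>
  may be replaced by any word for the same element.\<close>

lemma act_word_prod:
  assumes "xs \<in> lists S"
  shows "act (word_prod xs) = word_act xs"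
proof -
  define ys where "ys = (SOME ys. ys \<in> lists S \<and> word_prod ys = word_prod xs)"
  have "ys \<in> lists S \<and> word_prod ys = word_prod xs"
    unfolding ys_def by (rule someI_ex) (use assms in blast)
  then have "word_act ys = word_act xs"
    using word_prod_eq_imp[of ys xs word_act] word_act_relator_step assms by blast
  then show ?thesis unfolding act_def ys_def .
qed

section \<open>The linear action of the group on V\<close>

lemma act_one [simp]: "act \<one> v = v"
  using act_word_prod[of "[]"] by simp

lemma act_gen: "s \<in> S \<Longrightarrow> act s = simple_reflection s"
  using act_word_prod[of "[s]"] by auto

lemma act_mult:
  assumes "x \<in> carrier W" "y \<in> carrier W"
  shows "act (x \<otimes> y) v = act x (act y v)"
proof -
  obtain xs ys where "xs \<in> lists S" "word_prod xs = x" "ys \<in> lists S" "word_prod ys = y"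
    using assms by (metis ex_word)
  then show ?thesis
    using act_word_prod[of "xs @ ys"] act_word_prod[of xs] act_word_prod[of ys]
    by (auto simp: word_prod_append)
qed

lemma act_inv [simp]:
  "w \<in> carrier W \<Longrightarrow> act w (act (inv w) v) = v"
  "w \<in> carrier W \<Longrightarrow> act (inv w) (act w v) = v"
  by (simp_all flip: act_mult)

lemma act_linear:
  assumes "w \<in> carrier W"
  shows "act w (\<lambda>x. a * u x + b * v x) = (\<lambda>x. a * act w u x + b * act w v x)"
proof -
  obtain xs where "xs \<in> lists S" "word_prod xs = w" using assms ex_word by blast
  then have "act w = word_act xs" using act_word_prod by blast
  then show ?thesis by (simp only: word_act_linear)
qed

lemma act_uminus:
  assumes "w \<in> carrier W"
  shows "act w (\<lambda>x. - v x) = (\<lambda>x. - act w v x)"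
  using act_linear[OF assms, of "- 1" v 0 v] by simp

lemma bilinear_form_act:
  assumes "w \<in> carrier W"
  shows "bilinear_form (act w u) (act w v) = bilinear_form u v"
  by (metis assms ex_word act_word_prod bilinear_form_word_act)

lemma act_gen_simple_root:
  assumes "s \<in> S"
  shows "act s (simple_root s) = (\<lambda>x. - simple_root s x)"
  using assms by (auto simp: act_gen simple_reflection_def)

section \<open>Positive and negative roots\<close>

text \<open>
  Split off from \<open>w\<close> the longest possible alternating word in \<open>s\<close> and a right descent \<open>t\<close>. The
  remaining factor has neither \<open>s\<close> nor \<open>t\<close> as right descent, so induction applies to it, and the
  alternating word maps \<open>\<alpha>\<^sub>s\<close> to a non-negative combination of \<open>\<alpha>\<^sub>s\<close> and \<open>\<alpha>\<^sub>t\<close>.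
\<close>
lemma act_simple_root_nonneg:
  assumes "w \<in> carrier W" "s \<in> S" "len (w \<otimes> s) = Suc (len w)" "r \<in> S"
  shows "act w (simple_root s) r \<ge> 0"
  using assms(1-3)
proof (induction "len w" arbitrary: w s rule: less_induct)
  case less
  note w = less.prems(1) and s = less.prems(2) and len_ws = less.prems(3)
  show ?case
  proof (cases "w = \<one>")
    case True
    then show ?thesis by (simp add: simple_root_def)
  next
    case False
    then obtain t where t: "t \<in> S" "len w = Suc (len (w \<otimes> t))"
      using ex_right_descent w by blast
    have "s \<noteq> t" using t len_ws by auto
    let ?a = "\<lambda>k. word_prod (alt_word s t k)"
    \<comment> \<open>\<open>K k\<close> says that an alternating word of length k splits off from w
      with lengths adding up. \<open>K 1\<close> holds because that word is [t] and t is a right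
      descent; k is bounded by \<open>len w\<close>, so a greatest one exists.\<close>
    define K where "K = (\<lambda>k. \<exists>v\<in>carrier W. w = v \<otimes> ?a k \<and> len w = len v + k)"
    define k where "k = Greatest K"
    have K1: "K 1" unfolding K_def using w t by (intro bexI[of _ "w \<otimes> t"]) (auto simp: m_assoc)
    have bound: "\<And>k. K k \<Longrightarrow> k \<le> len w" unfolding K_def by auto
    have "K k" "k \<ge> 1" and kmax: "\<not> K (Suc k)"
      using GreatestI_nat[of K, OF K1 bound] Greatest_le_nat[of K, OF K1 bound]
        Greatest_le_nat[of K "Suc k", OF _ bound] unfolding k_def by auto
    then obtain v where v: "v \<in> carrier W" "w = v \<otimes> ?a k" "len w = len v + k"
      unfolding K_def by blast
    have a: "?a j \<in> carrier W" "len (?a j) \<le> j" for j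
      using alt_word_in_lists[OF s t(1)] len_word_prod_le[of "alt_word s t j"]
      by (simp_all del: in_lists_conv_set)
    \<comment> \<open>p is the first letter of the alternating word of length k, and q is the letter
      that would extend it. If q shortened v, k would not be maximal; if p did, cancelling it would
      make w too short.\<close>
    define p where "p = (if even k then s else t)"
    define q where "q = (if even k then t else s)"
    have pq: "p \<in> S" "q \<in> S" using s t unfolding p_def q_def by auto
    have "len (v \<otimes> q) = Suc (len v)"
    proof (rule ccontr)
      assume "len (v \<otimes> q) \<noteq> Suc (len v)"
      then have "len v = Suc (len (v \<otimes> q))" using len_mult_gen[of q v] pq v by auto
      moreover have "w = v \<otimes> q \<otimes> ?a (Suc k)"
        using v pq a by (simp add: m_assoc flip: q_def)
      ultimately have "K (Suc k)" unfolding K_def using v pq by (intro bexI[of _ "v \<otimes> q"]) auto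
      then show False using kmax by blast
    qed
    moreover have "len (v \<otimes> p) = Suc (len v)"
    proof (rule ccontr)
      assume "len (v \<otimes> p) \<noteq> Suc (len v)"
      then have lv: "len v = Suc (len (v \<otimes> p))" using len_mult_gen[of p v] pq v by auto
      obtain j where j: "k = Suc j" using \<open>k \<ge> 1\<close> by (cases k) auto
      then have "w = v \<otimes> p \<otimes> ?a j"
        using v pq a unfolding j p_def by (auto simp: m_assoc)
      then have "len w \<le> len (v \<otimes> p) + len (?a j)"
        using len_mult_le[of "v \<otimes> p" "?a j"] v pq a by auto
      then show False using a(2)[of j] v lv j by auto
    qed
    ultimately have len_v: "len (v \<otimes> s) = Suc (len v)" "len (v \<otimes> t) = Suc (len v)"
      unfolding p_def q_def by (auto split: if_splits)
    have IH: "act v (simple_root s) r \<ge> 0" "act v (simple_root t) r \<ge> 0"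
      using less.hyps[of v] v \<open>k \<ge> 1\<close> len_v s t by auto
    let ?m = "ord (s \<otimes> t)"
    \<comment> \<open>Otherwise the braid relation rewrites the last m letters of the alternating
      word to end in s, and ws would be shorter than w.\<close>
    have km: "k < ?m" if m0: "?m \<noteq> 0"
    proof (rule ccontr)
      assume "\<not> k < ?m"
      then obtain us where us: "us \<in> lists S" "length us = k - ?m" "alt_word s t k = us @ alt_word s t ?m"
        using alt_word_split[of s t ?m k] s t by auto
      obtain j where j: "?m = Suc j" using m0 by (cases ?m) auto
      have "\<exists>zs\<in>lists S. length zs = j \<and> alt_word t s (Suc j) = zs @ [s]" for j
      proof (induction j)
        case 0
        then show ?case by simp
      next
        case (Suc j)
        then obtain zs where "zs \<in> lists S" "length zs = j" "alt_word t s (Suc j) = zs @ [s]"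
          by blast
        then show ?case using s t
          by (intro bexI[of _ "(if even (Suc j) then s else t) # zs"]) auto
      qed
      then obtain zs where zs: "zs \<in> lists S" "length zs = j" "alt_word t s ?m = zs @ [s]"
        unfolding j by blast
      have "?a k = word_prod us \<otimes> word_prod (alt_word t s ?m)"
        using us word_prod_alt_word_ord[OF s t(1)]
          word_prod_append[OF us(1) alt_word_in_lists[OF s t(1)]] by simp
      also have "\<dots> = word_prod (us @ zs) \<otimes> s"
        using zs us s by (simp add: word_prod_append m_assoc)
      finally have "w \<otimes> s = v \<otimes> word_prod (us @ zs)"
        using v zs us s by (simp add: m_assoc)
      then have "len (w \<otimes> s) \<le> len v + len (word_prod (us @ zs))"
        using len_mult_le[of v "word_prod (us @ zs)"] v us zs by simp
      also have "\<dots> < len w"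
        using len_word_prod_le[of "us @ zs"] us zs v j \<open>\<not> k < ?m\<close> by auto
      finally show False using len_ws by simp
    qed
    define c where "c = - coxeter_form s t"
    \<comment> \<open>The strict inequality k < m is what admits the index k + 1: then i * pi / m is
      at most pi and its sine is non-negative.\<close>
    have cheb: "cheb c i \<ge> 0" if "i \<le> Suc k" for i
    proof (cases "?m = 0")
      case True
      then have "c = 1" unfolding c_def coxeter_form_def by simp
      then show ?thesis by (simp add: cheb_one)
    next
      case False
      define \<theta> where "\<theta> = pi / real ?m"
      have c: "c = cos \<theta>" using False unfolding c_def coxeter_form_def \<theta>_def by simp
      have m2: "?m \<ge> 2" using ord_gen_mult_ge_2 s t \<open>s \<noteq> t\<close> False by blast
      then have "sin \<theta> > 0" unfolding \<theta>_def by (intro sin_gt_zero) (auto simp: field_simps)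
      moreover have "real i * \<theta> \<le> pi"
        using that km[OF False] m2 unfolding \<theta>_def by (simp add: field_simps)
      then have "sin (real i * \<theta>) \<ge> 0" by (intro sin_ge_zero) (auto simp: \<theta>_def)
      ultimately show ?thesis using cheb_cos[of \<theta> i] unfolding c
        by (metis mult_less_0_iff not_less not_less_iff_gr_or_eq)
    qed
    have "act w (simple_root s) = act v (word_act (alt_word s t k) (simple_root s))"
      using v a act_mult[of v "?a k"] act_word_prod[OF alt_word_in_lists[OF s t(1)]] by simp
    also have "\<dots> = (\<lambda>x. (if even k then cheb c (Suc k) else cheb c k) * act v (simple_root s) x
       + (if even k then cheb c k else cheb c (Suc k)) * act v (simple_root t) x)"
      unfolding word_act_alt_word[OF s t(1) c_def] act_linear[OF v(1)] ..
    finally show ?thesis using IH cheb[of k] cheb[of "Suc k"] by simp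
  qed
qed

section \<open>Every root is either positive or negative\<close>

lemma act_simple_root_in_roots: "w \<in> carrier W \<Longrightarrow> s \<in> S \<Longrightarrow> act w (simple_root s) \<in> roots"
  unfolding roots_def by blast

lemma act_in_roots:
  assumes w: "w \<in> carrier W" and "\<beta> \<in> roots"
  shows "act w \<beta> \<in> roots"
proof -
  obtain u s where u: "u \<in> carrier W" "s \<in> S" "\<beta> = act u (simple_root s)"
    using assms unfolding roots_def by blast
  then have "act w \<beta> = act (w \<otimes> u) (simple_root s)"
    using w by (simp add: act_mult)
  then show ?thesis using act_simple_root_in_roots u w by simp
qed

lemma simple_root_in_roots [simp]: "s \<in> S \<Longrightarrow> simple_root s \<in> roots"
  using act_simple_root_in_roots[of \<one> s] by simp

lemma simple_root_positive [simp]: "s \<in> S \<Longrightarrow> simple_root s \<in> positive_roots"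
  unfolding positive_roots_def by simp (simp add: simple_root_def)

lemma uminus_in_roots:
  assumes "\<beta> \<in> roots"
  shows "(\<lambda>x. - \<beta> x) \<in> roots"
proof -
  obtain w s where "w \<in> carrier W" "s \<in> S" "\<beta> = act w (simple_root s)"
    using assms unfolding roots_def by blast
  then have "(\<lambda>x. - \<beta> x) = act (w \<otimes> s) (simple_root s)"
    by (simp add: act_mult act_gen_simple_root act_uminus)
  with \<open>w \<in> carrier W\<close> \<open>s \<in> S\<close> show ?thesis
    using act_simple_root_in_roots[of "w \<otimes> s" s] by simp
qed

lemma root_norm: "\<beta> \<in> roots \<Longrightarrow> bilinear_form \<beta> \<beta> = 1"
  unfolding roots_def by (auto simp: bilinear_form_act)

lemma root_zero_outside:
  assumes "\<beta> \<in> roots" "x \<notin> S"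
  shows "\<beta> x = 0"
proof -
  obtain w s where w: "w \<in> carrier W" "s \<in> S" "\<beta> = act w (simple_root s)"
    using assms unfolding roots_def by blast
  obtain xs where xs: "xs \<in> lists S" "word_prod xs = w" using w ex_word by blast
  have "word_act xs (simple_root s) x = 0"
    using xs(1) w(2) assms(2) by (induction xs) (auto simp: simple_reflection_def simple_root_def)
  then show ?thesis using w xs act_word_prod by metis
qed

text \<open>Of w and ws, one is lengthened by s on the right, and their images of
  \<open>\<alpha>\<^sub>s\<close> are opposite; \<open>act_simple_root_nonneg\<close> applies to
  that one.\<close>

lemma roots_positive_or_negative:
  assumes "\<beta> \<in> roots"
  shows "\<beta> \<in> positive_roots \<or> negative \<beta>"
proof -
  obtain w s where w: "w \<in> carrier W" "s \<in> S" "\<beta> = act w (simple_root s)"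
    using assms unfolding roots_def by blast
  show ?thesis
  proof (cases "len (w \<otimes> s) = Suc (len w)")
    case True
    then have "\<beta> \<in> positive_roots"
      using act_simple_root_nonneg[of w s] w assms unfolding positive_roots_def by auto
    then show ?thesis ..
  next
    case False
    then have "len (w \<otimes> s \<otimes> s) = Suc (len (w \<otimes> s))"
      using len_mult_gen[of s w] w by auto
    then have "act (w \<otimes> s) (simple_root s) x \<ge> 0" if "x \<in> S" for x
      using act_simple_root_nonneg[of "w \<otimes> s" s] w that by auto
    moreover have "act (w \<otimes> s) (simple_root s) = (\<lambda>x. - \<beta> x)"
      using w by (simp add: act_mult act_gen_simple_root act_uminus)
    ultimately have "negative \<beta>"
      using uminus_in_roots[OF assms] unfolding negative_def positive_roots_def by auto
    then show ?thesis ..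
  qed
qed

text \<open>All coefficients on S would vanish, whereas roots have norm 1.\<close>

lemma not_positive_and_negative: "\<beta> \<in> positive_roots \<Longrightarrow> \<not> negative \<beta>"
proof
  assume \<beta>: "\<beta> \<in> positive_roots" "negative \<beta>"
  then have "\<beta> s = 0" if "s \<in> S" for s
    using that unfolding negative_def positive_roots_def by force
  then have "bilinear_form \<beta> \<beta> = 0" unfolding bilinear_form_def by simp
  then show False using \<beta> root_norm unfolding positive_roots_def by force
qed

lemma positive_iff_not_negative: "\<beta> \<in> roots \<Longrightarrow> \<beta> \<in> positive_roots \<longleftrightarrow> \<not> negative \<beta>"
  using roots_positive_or_negative not_positive_and_negative by blast

lemma positive_roots_subset: "\<beta> \<in> positive_roots \<Longrightarrow> \<beta> \<in> roots"
  unfolding positive_roots_def by blast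

text \<open>The reflection s alters only the coefficient at s. Norm 1 prevents a positive root other
  than \<open>\<alpha>\<^sub>s\<close> from being a multiple of \<open>\<alpha>\<^sub>s\<close>, so
  some other coefficient is positive; it stays positive, and the image cannot be negative.\<close>

lemma act_gen_positive:
  assumes s: "s \<in> S" and \<beta>: "\<beta> \<in> positive_roots" "\<beta> \<noteq> simple_root s"
  shows "act s \<beta> \<in> positive_roots"
proof -
  have root: "\<beta> \<in> roots" "act s \<beta> \<in> roots"
    using s \<beta> positive_roots_subset act_in_roots by auto
  have "\<exists>t\<in>S. t \<noteq> s \<and> \<beta> t \<noteq> 0"
  proof (rule ccontr)
    assume "\<not> (\<exists>t\<in>S. t \<noteq> s \<and> \<beta> t \<noteq> 0)"
    then have eq: "\<beta> = (\<lambda>x. \<beta> s * simple_root s x + 0 * simple_root s x)"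
      using root_zero_outside[OF root(1)] by (intro ext) (force simp: simple_root_def)
    have "bilinear_form \<beta> \<beta> = \<beta> s * \<beta> s"
      by (subst (1 2) eq, simp only: bilinear_form_linear_left bilinear_form_linear_right)
        (use s in simp)
    then have "\<beta> s * \<beta> s = 1" using root_norm[OF root(1)] by simp
    then have "\<beta> s = 1"
      using \<beta> s unfolding positive_roots_def by (auto simp: square_eq_1_iff)
    then show False using eq \<beta>(2) by auto
  qed
  then obtain t where t: "t \<in> S" "t \<noteq> s" "\<beta> t \<noteq> 0" by blast
  then have "act s \<beta> t > 0"
    using s \<beta> unfolding positive_roots_def act_gen[OF s] simple_reflection_def
    by (auto simp: simple_root_def less_le)
  then have "\<not> negative (act s \<beta>)"
    using t unfolding negative_def positive_roots_def by force
  then show ?thesis using positive_iff_not_negative root by blast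
qed

section \<open>Reflections\<close>

text \<open>A non-trivial w has a right descent s, and then ws maps \<open>\<alpha>\<^sub>s\<close>
  to a non-negative vector. If w acted trivially, this vector would be
  \<open>- \<alpha>\<^sub>s\<close>.\<close>

lemma act_faithful:
  assumes w: "w \<in> carrier W" and id: "\<And>v. act w v = v"
  shows "w = \<one>"
proof (rule ccontr)
  assume "w \<noteq> \<one>"
  then obtain s where s: "s \<in> S" "len w = Suc (len (w \<otimes> s))"
    using ex_right_descent w by blast
  then have "act (w \<otimes> s) (simple_root s) s \<ge> 0"
    using act_simple_root_nonneg[of "w \<otimes> s" s s] w by simp
  moreover have "act (w \<otimes> s) (simple_root s) = (\<lambda>x. - simple_root s x)"
    using s w id by (simp add: act_mult act_gen_simple_root)
  ultimately show False by (simp add: simple_root_def)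
qed

lemma act_reflection:
  assumes u: "u \<in> carrier W" "s \<in> S" and \<beta>: "\<beta> = act u (simple_root s)"
  shows "act (u \<otimes> s \<otimes> inv u) v = (\<lambda>x. v x - 2 * bilinear_form v \<beta> * \<beta> x)"
proof -
  have "bilinear_form (act (inv u) v) (simple_root s) = bilinear_form v \<beta>"
    using bilinear_form_act[of u "act (inv u) v" "simple_root s"] u \<beta> by simp
  then have "act (u \<otimes> s \<otimes> inv u) v = act u (\<lambda>x. 1 * act (inv u) v x + (- 2 * bilinear_form v \<beta>) * simple_root s x)"
    using u by (simp add: act_mult act_gen simple_reflection_def)
  also have "\<dots> = (\<lambda>x. v x - 2 * bilinear_form v \<beta> * \<beta> x)"
    unfolding act_linear[OF u(1)] using u \<beta> by auto
  finally show ?thesis .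
qed

text \<open>By \<open>act_reflection\<close> the action of the conjugate depends only on the root,
  and the action is faithful. This makes the \<open>THE\<close> in \<open>root_reflection\<close>
  well defined.\<close>

lemma reflection_unique:
  assumes "u \<in> carrier W" "s \<in> S" "u' \<in> carrier W" "s' \<in> S"
    and "act u (simple_root s) = act u' (simple_root s')"
  shows "u \<otimes> s \<otimes> inv u = u' \<otimes> s' \<otimes> inv u'"
proof -
  let ?r = "u \<otimes> s \<otimes> inv u" and ?r' = "u' \<otimes> s' \<otimes> inv u'"
  have r: "?r \<in> carrier W" "?r' \<in> carrier W" using assms by auto
  have "act ?r v = act ?r' v" for v
    using act_reflection[of u s] act_reflection[of u' s'] assms by metis
  then have "act (?r \<otimes> inv ?r') v = v" for v
    using r act_mult[of ?r "inv ?r'"] by simp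
  then have "?r \<otimes> inv ?r' = \<one>" using act_faithful[of "?r \<otimes> inv ?r'"] r by blast
  then show ?thesis using r by (metis inv_equality inv_inv inv_closed)
qed

lemma root_reflection_act:
  assumes "u \<in> carrier W" "s \<in> S"
  shows "root_reflection (act u (simple_root s)) = u \<otimes> s \<otimes> inv u"
  unfolding root_reflection_def
proof (rule the_equality)
  show "\<exists>w\<in>carrier W. \<exists>s'\<in>S. act u (simple_root s) = act w (simple_root s') \<and>
      u \<otimes> s \<otimes> inv u = w \<otimes> s' \<otimes> inv w"
    using assms by (intro bexI[of _ u] bexI[of _ s] conjI refl)
next
  fix r
  assume "\<exists>w\<in>carrier W. \<exists>s'\<in>S. act u (simple_root s) = act w (simple_root s') \<and>
      r = w \<otimes> s' \<otimes> inv w"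
  then obtain w s' where w: "w \<in> carrier W" "s' \<in> S"
    "act u (simple_root s) = act w (simple_root s')" "r = w \<otimes> s' \<otimes> inv w" by blast
  show "r = u \<otimes> s \<otimes> inv u"
    using reflection_unique[OF assms w(1,2,3)] w(4) by simp
qed

lemma root_reflection_simple [simp]: "s \<in> S \<Longrightarrow> root_reflection (simple_root s) = s"
  using root_reflection_act[of \<one> s] by simp

lemma root_reflection_act_root:
  assumes "w \<in> carrier W" "\<beta> \<in> roots"
  shows "root_reflection (act w \<beta>) = w \<otimes> root_reflection \<beta> \<otimes> inv w"
proof -
  obtain u s where u: "u \<in> carrier W" "s \<in> S" "\<beta> = act u (simple_root s)"
    using assms unfolding roots_def by blast
  then show ?thesis
    using assms root_reflection_act[of u s] root_reflection_act[of "w \<otimes> u" s]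
    by (simp add: act_mult inv_mult_group m_assoc)
qed

lemma root_reflection_props:
  assumes "\<beta> \<in> roots"
  shows root_reflection_closed: "root_reflection \<beta> \<in> carrier W"
    and root_reflection_sq: "root_reflection \<beta> \<otimes> root_reflection \<beta> = \<one>"
    and odd_len_root_reflection: "odd (len (root_reflection \<beta>))"
    and act_root_reflection: "act (root_reflection \<beta>) \<beta> = (\<lambda>x. - \<beta> x)"
proof -
  obtain u s where u: "u \<in> carrier W" "s \<in> S" "\<beta> = act u (simple_root s)"
    using assms unfolding roots_def by blast
  then have r: "root_reflection \<beta> = u \<otimes> s \<otimes> inv u"
    using root_reflection_act by simp
  show "root_reflection \<beta> \<in> carrier W" using u unfolding r by simp
  have "u \<otimes> s \<otimes> inv u \<otimes> (u \<otimes> s \<otimes> inv u) = u \<otimes> s \<otimes> (inv u \<otimes> u) \<otimes> s \<otimes> inv u"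
    using u by (simp only: m_assoc inv_closed m_closed gen_closed)
  then show "root_reflection \<beta> \<otimes> root_reflection \<beta> = \<one>"
    using u unfolding r by simp
  show "odd (len (root_reflection \<beta>))"
    using u unfolding r by (simp add: even_len_mult)
  show "act (root_reflection \<beta>) \<beta> = (\<lambda>x. - \<beta> x)"
    using act_reflection[OF u, of \<beta>] root_norm[OF assms] unfolding r by auto
qed

text \<open>Let r be the reflection of \<beta>. Strip a left descent s from w: the length hypothesis
  passes to sw, so (sw)\<beta> is positive by induction. Applying s keeps it positive unless it is
  \<open>\<alpha>\<^sub>s\<close>; in that case wr = sw would be shorter than w.\<close>

lemma act_positive_of_len:
  assumes "w \<in> carrier W" "\<beta> \<in> positive_roots" "len (w \<otimes> root_reflection \<beta>) > len w"
  shows "act w \<beta> \<in> positive_roots"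
  using assms(1,3)
proof (induction "len w" arbitrary: w rule: less_induct)
  case less
  let ?r = "root_reflection \<beta>"
  have \<beta>: "\<beta> \<in> roots" using assms positive_roots_subset by blast
  have r: "?r \<in> carrier W" using root_reflection_closed[OF \<beta>] .
  show ?case
  proof (cases "w = \<one>")
    case True
    then show ?thesis using assms(2) by simp
  next
    case False
    then have "inv w \<noteq> \<one>" using less.prems(1) by simp
    then obtain s where s: "s \<in> S" "len (inv w) = Suc (len (inv w \<otimes> s))"
      using ex_right_descent less.prems(1) by (metis inv_closed)
    moreover have "inv w \<otimes> s = inv (s \<otimes> w)" using s less.prems by (simp add: inv_mult_group)
    ultimately have sw: "len w = Suc (len (s \<otimes> w))" using less.prems by simp
    have "len (w \<otimes> ?r) \<le> Suc (len (s \<otimes> w \<otimes> ?r))"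
      using len_gen_mult[of s "w \<otimes> ?r"] s less.prems r by (auto simp: m_assoc)
    then have pos: "act (s \<otimes> w) \<beta> \<in> positive_roots"
      using less.hyps[of "s \<otimes> w"] less.prems s sw by simp
    have w\<beta>: "act w \<beta> = act s (act (s \<otimes> w) \<beta>)"
      using s less.prems by (simp flip: act_mult)
    have "act (s \<otimes> w) \<beta> \<noteq> simple_root s"
    proof
      assume "act (s \<otimes> w) \<beta> = simple_root s"
      then have "s = (s \<otimes> w) \<otimes> ?r \<otimes> inv (s \<otimes> w)"
        using root_reflection_act_root[of "s \<otimes> w" \<beta>] \<beta> s less.prems by simp
      then have "s \<otimes> (s \<otimes> w) = s \<otimes> w \<otimes> ?r"
        using s less.prems r by (metis gen_closed inv_closed inv_solve_right m_closed)
      then have "w \<otimes> ?r = s \<otimes> w"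
        using s less.prems r by (metis gen_cancel m_assoc gen_closed m_closed)
      then show False using less.prems sw by simp
    qed
    then show ?thesis unfolding w\<beta> using act_gen_positive s pos by blast
  qed
qed

text \<open>One direction is \<open>act_positive_of_len\<close> for w, with equal lengths excluded
  by parity. The other is the same lemma for wr, where r is the reflection of \<beta>, since wr maps
  \<beta> to -w\<beta>.\<close>

lemma act_negative_iff_len:
  assumes w: "w \<in> carrier W" and \<beta>: "\<beta> \<in> positive_roots"
  shows "negative (act w \<beta>) \<longleftrightarrow> len (w \<otimes> root_reflection \<beta>) < len w"
proof -
  let ?r = "root_reflection \<beta>"
  have root: "\<beta> \<in> roots" using \<beta> positive_roots_subset by blast
  note r = root_reflection_closed[OF root]
  have ne: "len (w \<otimes> ?r) \<noteq> len w"
    using even_len_mult[of w ?r] odd_len_root_reflection[OF root] w r by auto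
  have "negative (act w \<beta>)" if "len (w \<otimes> ?r) < len w"
  proof -
    have "w \<otimes> ?r \<otimes> ?r = w"
      using w r root_reflection_sq[OF root] by (simp add: m_assoc)
    then have "act (w \<otimes> ?r) \<beta> \<in> positive_roots"
      using act_positive_of_len[of "w \<otimes> ?r" \<beta>] w r \<beta> that by simp
    then show ?thesis
      using w r by (simp add: act_mult act_root_reflection[OF root] act_uminus negative_def)
  qed
  moreover have "\<not> negative (act w \<beta>)" if "\<not> len (w \<otimes> ?r) < len w"
    using that act_positive_of_len[OF w \<beta>] ne not_positive_and_negative by auto
  ultimately show ?thesis by blast
qed

lemma inv_act_negative_iff_len:
  assumes w: "w \<in> carrier W" and \<beta>: "\<beta> \<in> positive_roots"
  shows "negative (act (inv w) \<beta>) \<longleftrightarrow> len (root_reflection \<beta> \<otimes> w) < len w"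
proof -
  let ?r = "root_reflection \<beta>"
  have root: "\<beta> \<in> roots" using \<beta> positive_roots_subset by blast
  note r = root_reflection_closed[OF root]
  have "inv (?r \<otimes> w) = inv w \<otimes> ?r"
    using w r inv_equality[OF root_reflection_sq[OF root]] by (simp add: inv_mult_group)
  then show ?thesis
    using act_negative_iff_len[of "inv w" \<beta>] w \<beta> len_inv[of "?r \<otimes> w"] r by simp
qed

lemma mem_pos_halfspace:
  assumes w: "w \<in> carrier W" and \<beta>: "\<beta> \<in> positive_roots"
  shows "w \<in> pos_halfspace \<beta> \<longleftrightarrow> \<not> negative (act (inv w) \<beta>)"
proof -
  have root: "\<beta> \<in> roots" using \<beta> positive_roots_subset by blast
  have "len (root_reflection \<beta> \<otimes> w) \<noteq> len w"
    using even_len_mult[of "root_reflection \<beta>" w] odd_len_root_reflection[OF root]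
      root_reflection_closed[OF root] w by auto
  then show ?thesis
    unfolding pos_halfspace_def using w inv_act_negative_iff_len[OF w \<beta>] by auto
qed

lemma left_descent_iff_negative:
  "w \<in> carrier W \<Longrightarrow> s \<in> left_descents w \<longleftrightarrow> s \<in> S \<and> negative (act (inv w) (simple_root s))"
  using inv_act_negative_iff_len[of w "simple_root s"] len_gen_mult[of s w]
  unfolding left_descents_iff by auto

section \<open>Joins in the weak order\<close>

abbreviation weak_le :: "'a \<Rightarrow> 'a \<Rightarrow> bool" (infix "\<preceq>" 50) where
  "x \<preceq> y \<equiv> x \<sqsubseteq>\<^bsub>weak_order\<^esub> y"

lemma weak_le_iff:
  assumes "x \<in> carrier W" "y \<in> carrier W"
  shows "x \<preceq> y \<longleftrightarrow> len x + len (inv x \<otimes> y) = len y"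
  unfolding weak_order_def by auto

lemma weak_le_trans:
  assumes "x \<in> carrier W" "y \<in> carrier W" "z \<in> carrier W" "x \<preceq> y" "y \<preceq> z"
  shows "x \<preceq> z"
proof -
  have "inv x \<otimes> z = (inv x \<otimes> y) \<otimes> (inv y \<otimes> z)"
    using assms by (simp add: m_assoc inv_solve_left flip: m_assoc[of y])
  then have "len (inv x \<otimes> z) \<le> len (inv x \<otimes> y) + len (inv y \<otimes> z)"
    using len_mult_le[of "inv x \<otimes> y" "inv y \<otimes> z"] assms by simp
  moreover have "len z \<le> len x + len (inv x \<otimes> z)"
    using len_mult_le[of x "inv x \<otimes> z"] assms by (simp flip: m_assoc)
  ultimately show ?thesis using assms by (simp add: weak_le_iff)
qed

lemma gen_weak_le_iff: "s \<in> S \<Longrightarrow> w \<in> carrier W \<Longrightarrow> s \<preceq> w \<longleftrightarrow> s \<in> left_descents w"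
  by (auto simp: weak_le_iff left_descents_iff)

text \<open>The extension step for lower bounds. Put v = \<open>inv z \<otimes> x\<close> and let
  \<beta> be the image of \<open>\<alpha>\<^sub>s\<close> under \<open>inv z\<close>. Then \<beta>
  is positive because s is not below z, and \<open>inv v\<close> makes it negative because s is
  below x. Hence the reflection of \<beta> shortens v, and the shortened element is
  \<open>inv (s \<otimes> z) \<otimes> x\<close>.\<close>

lemma gen_mult_weak_le:
  assumes s: "s \<in> S" "x \<in> carrier W" "z \<in> carrier W"
    and "s \<preceq> x" "z \<preceq> x" "\<not> s \<preceq> z"
  shows "len (s \<otimes> z) = Suc (len z)" and "s \<otimes> z \<preceq> x"
proof -
  show len: "len (s \<otimes> z) = Suc (len z)"
    using assms gen_weak_le_iff not_left_descent by blast
  let ?v = "inv z \<otimes> x" and ?\<beta> = "act (inv z) (simple_root s)"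
  have v: "?v \<in> carrier W" using s by simp
  have root: "?\<beta> \<in> roots" using s act_in_roots by auto
  have "\<not> negative ?\<beta>"
    using assms gen_weak_le_iff[of s z] left_descent_iff_negative[of z s] by auto
  then have \<beta>: "?\<beta> \<in> positive_roots" using positive_iff_not_negative root by blast
  have "inv ?v \<otimes> inv z = inv x"
    using s by (simp add: inv_mult_group m_assoc)
  then have "act (inv ?v) ?\<beta> = act (inv x) (simple_root s)"
    using act_mult[of "inv ?v" "inv z"] s by simp
  moreover have "negative (act (inv x) (simple_root s))"
    using assms gen_weak_le_iff[of s x] left_descent_iff_negative[of x s] by auto
  ultimately have "len (root_reflection ?\<beta> \<otimes> ?v) < len ?v"
    using inv_act_negative_iff_len[OF v \<beta>] by simp
  moreover have "root_reflection ?\<beta> \<otimes> ?v = inv (s \<otimes> z) \<otimes> x"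
    using root_reflection_act[of "inv z" s] s by (simp add: m_assoc inv_mult_group)
  ultimately have "len (inv (s \<otimes> z) \<otimes> x) < len ?v" by simp
  moreover have "len x \<le> len (s \<otimes> z) + len (inv (s \<otimes> z) \<otimes> x)"
    using len_mult_le[of "s \<otimes> z" "inv (s \<otimes> z) \<otimes> x"] s by (simp flip: m_assoc)
  ultimately show "s \<otimes> z \<preceq> x"
    using len assms(5) s by (simp add: weak_le_iff)
qed

text \<open>A common lower bound m of maximal length is the meet. Induction on the length of another
  lower bound u, dropping its last letter, shows that u lies below m; otherwise
  \<open>gen_mult_weak_le\<close> would produce a longer common lower bound.\<close>

lemma weak_meet:
  assumes A: "A \<subseteq> carrier W" "A \<noteq> {}"
  shows "\<exists>m\<in>carrier W. (\<forall>x\<in>A. m \<preceq> x) \<and> (\<forall>u\<in>carrier W. (\<forall>x\<in>A. u \<preceq> x) \<longrightarrow> u \<preceq> m)"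
proof -
  define L where "L = (\<lambda>n. \<exists>m\<in>carrier W. len m = n \<and> (\<forall>x\<in>A. m \<preceq> x))"
  define N where "N = Greatest L"
  obtain a where a: "a \<in> A" "a \<in> carrier W" using A by blast
  have "L 0" unfolding L_def using A by (intro bexI[of _ \<one>]) (auto simp: weak_le_iff)
  moreover have "n \<le> len a" if "L n" for n
    using that a unfolding L_def by (auto simp: weak_le_iff)
  ultimately have "L N" and max: "\<And>n. L n \<Longrightarrow> n \<le> N"
    unfolding N_def by (auto intro: GreatestI_nat Greatest_le_nat)
  then obtain m where m: "m \<in> carrier W" "\<And>x. x \<in> A \<Longrightarrow> m \<preceq> x" "len m = N"
    unfolding L_def by blast
  have mmax: "len m' \<le> len m" if "m' \<in> carrier W" "\<forall>x\<in>A. m' \<preceq> x" for m'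
    using max[of "len m'"] that m(3) unfolding L_def by blast
  have "u \<preceq> m" if "u \<in> carrier W" "\<forall>x\<in>A. u \<preceq> x" for u
    using that
  proof (induction "len u" arbitrary: u)
    case 0
    then have "u = \<one>" using ex_right_descent[of u] by force
    then show ?case using m by (simp add: weak_le_iff)
  next
    case (Suc n)
    then have "u \<noteq> \<one>" by auto
    then obtain s where s: "s \<in> S" "len u = Suc (len (u \<otimes> s))"
      using ex_right_descent Suc.prems by blast
    let ?v = "u \<otimes> s"
    have v: "?v \<in> carrier W" using s Suc.prems by simp
    have vu: "?v \<preceq> u" using s Suc.prems by (simp add: weak_le_iff inv_mult_group m_assoc)
    have vx: "?v \<preceq> x" if "x \<in> A" for x
      using weak_le_trans[OF v _ _ vu, of x] Suc.prems A that by blast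
    then have vm: "?v \<preceq> m" using Suc.hyps(1)[of ?v] Suc.hyps(2) s v by simp
    show ?case
    proof (rule ccontr)
      assume "\<not> u \<preceq> m"
      let ?z = "inv ?v \<otimes> m"
      have z: "?z \<in> carrier W" using v m by simp
      \<comment> \<open>Translating by the common lower bound \<open>v = u s\<close> reduces the comparison of \<open>u\<close> with \<open>m\<close>
        to that of the generator \<open>s\<close> with \<open>v\<inverse> m\<close>.\<close>
      have shift: "u \<preceq> x \<longleftrightarrow> s \<preceq> inv ?v \<otimes> x" if "x \<in> carrier W" "?v \<preceq> x" for x
      proof -
        have "inv s \<otimes> (inv ?v \<otimes> x) = inv u \<otimes> x"
          using that s Suc.prems by (simp add: inv_mult_group m_assoc)
        moreover have "len ?v + len (inv ?v \<otimes> x) = len x"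
          using that weak_le_iff[OF v] by blast
        ultimately show ?thesis
          using that s v weak_le_iff[of u x] weak_le_iff[of s "inv ?v \<otimes> x"] Suc.prems(1) by auto
      qed
      have ns: "\<not> s \<preceq> ?z" using shift[OF m(1) vm] \<open>\<not> u \<preceq> m\<close> by blast
      \<comment> \<open>Inserting s between v and \<open>inv ?v \<otimes> m\<close> gives an element
        one longer than m that is still below every x in A.\<close>
      let ?m' = "?v \<otimes> (s \<otimes> ?z)"
      have m': "?m' \<in> carrier W" using v z s by simp
      have x: "?m' \<preceq> x \<and> len ?m' = Suc (len m)" if "x \<in> A" for x
      proof -
        let ?y = "inv ?v \<otimes> x"
        have xc: "x \<in> carrier W" using that A by blast
        then have y: "?y \<in> carrier W" using v by simp
        have "s \<preceq> ?y" using shift[OF xc vx[OF that]] Suc.prems that by blast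
        moreover have "inv ?z \<otimes> ?y = inv m \<otimes> x"
          using v m xc by (simp add: inv_mult_group[of "inv ?v"] m_assoc)
        then have "?z \<preceq> ?y"
          using m(2)[OF that] vm vx[OF that] m(1) xc y z v by (simp add: weak_le_iff)
        ultimately have sz: "len (s \<otimes> ?z) = Suc (len ?z)" "s \<otimes> ?z \<preceq> ?y"
          using gen_mult_weak_le[OF s(1) y z] ns by auto
        have "inv ?m' \<otimes> x = inv (s \<otimes> ?z) \<otimes> ?y"
          using v z s xc by (simp add: inv_mult_group[of ?v] m_assoc)
        then have e: "len (s \<otimes> ?z) + len (inv ?m' \<otimes> x) = len ?y"
          using sz s z y by (simp add: weak_le_iff)
        moreover have "len ?v + len ?y = len x" "len ?v + len ?z = len m"
          using vx[OF that] vm v xc m by (simp_all add: weak_le_iff)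
        moreover have "len ?m' \<le> len ?v + len (s \<otimes> ?z)" "len x \<le> len ?m' + len (inv ?m' \<otimes> x)"
          using len_mult_le[of ?v "s \<otimes> ?z"] len_mult_le[of ?m' "inv ?m' \<otimes> x"] v s z xc m'
          by (simp_all flip: m_assoc[of ?m'])
        ultimately show ?thesis using sz m' xc by (simp add: weak_le_iff)
      qed
      then show False using mmax[OF m'] a by fastforce
    qed
  qed
  then show ?thesis using m by blast
qed

text \<open>The join is the meet of all upper bounds: each element of X lies below every upper
  bound, hence below their meet.\<close>

lemma weak_sup_least:
  assumes X: "X \<subseteq> carrier W" and bounded: "Upper weak_order X \<noteq> {}"
  shows "least weak_order (\<Squnion>\<^bsub>weak_order\<^esub> X) (Upper weak_order X)"
proof -
  have [simp]: "carrier weak_order = carrier W" unfolding weak_order_def by simp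
  have U: "Upper weak_order X = {u \<in> carrier W. \<forall>x\<in>X. x \<preceq> u}"
    using X unfolding Upper_def by auto
  obtain m where m: "m \<in> carrier W" "\<forall>x\<in>Upper weak_order X. m \<preceq> x"
    "\<forall>u\<in>carrier W. (\<forall>x\<in>Upper weak_order X. u \<preceq> x) \<longrightarrow> u \<preceq> m"
    using weak_meet[of "Upper weak_order X"] bounded unfolding U by blast
  have "\<forall>x\<in>X. x \<preceq> m" using m(3) X unfolding U by blast
  then have "least weak_order m (Upper weak_order X)"
    using m unfolding least_def U by auto
  then show ?thesis unfolding sup_def by (rule someI)
qed

section \<open>Garside partitions\<close>

text \<open>Removing s from b and from \<open>s \<otimes> x\<close> lowers both lengths by one and
  leaves the quotient \<open>inv b \<otimes> (s \<otimes> x)\<close> unchanged.\<close>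

lemma weak_le_gen_mult_iff:
  assumes "s \<in> S" "b \<in> carrier W" "x \<in> carrier W"
    and "s \<in> left_descents b" "len (s \<otimes> x) = Suc (len x)"
  shows "b \<preceq> s \<otimes> x \<longleftrightarrow> s \<otimes> b \<preceq> x"
  using assms by (auto simp: weak_le_iff left_descents_iff inv_mult_group m_assoc)

lemma regular_garside_partition:
  assumes B: "garside_shadow B"
  shows "regular_partition (garside_partition B)"
  unfolding garside_partition_def
proof (rule regular_induced_partition)
  have BW: "B \<subseteq> carrier W" and SB: "S \<subseteq> B"
    and sup: "\<And>X. X \<subseteq> B \<Longrightarrow> Upper weak_order X \<noteq> {} \<Longrightarrow> \<Squnion>\<^bsub>weak_order\<^esub> X \<in> B"
    and suffix: "\<And>b u. b \<in> B \<Longrightarrow> u \<in> carrier W \<Longrightarrow> suffix_of u b \<Longrightarrow> u \<in> B"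
    using B unfolding garside_shadow_def by blast+
  {
    fix x y
    assume xy: "x \<in> carrier W" "y \<in> carrier W" "\<forall>X\<in>cone ` B. x \<in> X \<longleftrightarrow> y \<in> X"
    have "s \<in> left_descents x \<longleftrightarrow> s \<in> left_descents y" if "s \<in> S" for s
    proof -
      have "x \<in> cone s \<longleftrightarrow> y \<in> cone s" using xy(3) that SB by blast
      then show ?thesis
        using gen_weak_le_iff[OF that xy(1)] gen_weak_le_iff[OF that xy(2)] xy(1,2)
        unfolding cone_def by blast
    qed
    then show "left_descents x = left_descents y"
      unfolding left_descents_def by blast
  next
    fix s x y X
    assume s: "s \<in> S" "x \<in> carrier W" "y \<in> carrier W"
      and same: "\<forall>X\<in>cone ` B. x \<in> X \<longleftrightarrow> y \<in> X"
      and len: "len (s \<otimes> x) = Suc (len x)" "len (s \<otimes> y) = Suc (len y)"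
      and X: "X \<in> cone ` B" "s \<otimes> x \<in> X"
    then obtain b where b: "b \<in> B" "X = cone b" "b \<preceq> s \<otimes> x" "b \<in> carrier W"
      using BW unfolding cone_def by auto
    have sx: "s \<otimes> x \<in> carrier W" "s \<otimes> y \<in> carrier W" using s by auto
    let ?z = "\<Squnion>\<^bsub>weak_order\<^esub> {s, b}"
    have "s \<preceq> s \<otimes> x" using s len by (simp add: gen_weak_le_iff left_descents_iff)
    then have ub: "s \<otimes> x \<in> Upper weak_order {s, b}"
      using b sx unfolding Upper_def by (auto simp: weak_order_def)
    then have "least weak_order ?z (Upper weak_order {s, b})"
      using weak_sup_least[of "{s, b}"] s b by auto
    then have "?z \<in> Upper weak_order {s, b}" and zx: "?z \<preceq> s \<otimes> x"
      using ub unfolding least_def by auto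
    then have z: "s \<preceq> ?z" "b \<preceq> ?z" "?z \<in> carrier W"
      using s b unfolding Upper_def by (auto simp: weak_order_def)
    have zB: "?z \<in> B" using sup[of "{s, b}"] ub s b SB by auto
    have sz: "s \<in> left_descents ?z" using z s gen_weak_le_iff by blast
    \<comment> \<open>With z the join, z times the inverse of sz is s, and sz is one shorter than
      z.\<close>
    then have "suffix_of (s \<otimes> ?z) ?z"
      using s z unfolding suffix_of_def left_descents_iff
      by (simp add: inv_mult_group flip: m_assoc)
    then have "s \<otimes> ?z \<in> B" using suffix[OF zB] s z by simp
    then have "s \<otimes> ?z \<preceq> x \<longleftrightarrow> s \<otimes> ?z \<preceq> y"
      using same s unfolding cone_def by auto
    then have "?z \<preceq> s \<otimes> y"
      using zx weak_le_gen_mult_iff[OF s(1) z(3) _ sz] s len by auto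
    then have "b \<preceq> s \<otimes> y" using weak_le_trans[of b ?z "s \<otimes> y"] z b sx by blast
    then show "s \<otimes> y \<in> X" using b sx unfolding cone_def by auto
  }
qed

section \<open>Shi partitions\<close>

text \<open>Test domination at w = s: this element makes \<open>\<alpha>\<^sub>s\<close> negative
  and keeps every other positive root positive.\<close>

lemma dominates_simple_root:
  assumes "s \<in> S" "\<alpha> \<in> positive_roots" "dominates (simple_root s) \<alpha>"
  shows "\<alpha> = simple_root s"
proof (rule ccontr)
  assume "\<alpha> \<noteq> simple_root s"
  then have "\<not> negative (act s \<alpha>)"
    using act_gen_positive assms not_positive_and_negative by blast
  moreover have "negative (act s (simple_root s))"
    using assms(1) by (simp add: act_gen_simple_root negative_def)
  ultimately show False
    using assms unfolding dominates_def by (metis gen_closed gen_inv)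
qed

text \<open>Thus for every n, including 0, the walls of the simple roots are among the defining
  ones, and the parts determine left descents.\<close>

lemma simple_root_small:
  assumes "s \<in> S"
  shows "simple_root s \<in> small_roots n"
proof -
  have D: "{\<alpha> \<in> positive_roots - {simple_root s}. dominates (simple_root s) \<alpha>} = {}"
    using assms dominates_simple_root by blast
  show ?thesis unfolding small_roots_def mem_Collect_eq D using assms by simp
qed

lemma dominates_act_gen:
  assumes s: "s \<in> S" and dom: "dominates (act s \<beta>) \<alpha>"
  shows "dominates \<beta> (act s \<alpha>)"
  unfolding dominates_def
proof (intro ballI impI)
  fix w
  assume w: "w \<in> carrier W" and neg: "negative (act (inv w) \<beta>)"
  have act_sw: "act (inv (s \<otimes> w)) v = act (inv w) (act s v)" for v
    using s w by (simp add: inv_mult_group act_mult)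
  have "negative (act (inv (s \<otimes> w)) (act s \<beta>))"
    unfolding act_sw using neg s by (simp add: act_gen)
  then have "negative (act (inv (s \<otimes> w)) \<alpha>)"
    using dom[unfolded dominates_def, rule_format, of "s \<otimes> w"] s w by simp
  then show "negative (act (inv w) (act s \<alpha>))"
    unfolding act_sw .
qed

text \<open>
  If \<open>s \<beta>\<close> does not dominate \<open>\<alpha>\<^sub>s\<close>, then \<open>s\<close> maps the roots dominated by \<open>s \<beta>\<close> injectively to
  positive roots dominated by \<open>\<beta>\<close>.
\<close>
lemma small_root_act_gen:
  assumes s: "s \<in> S" and \<beta>: "\<beta> \<in> small_roots n" "\<beta> \<noteq> simple_root s"
    and dom: "\<not> dominates (act s \<beta>) (simple_root s)"
  shows "act s \<beta> \<in> small_roots n"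
proof -
  let ?D = "\<lambda>\<beta>. {\<alpha> \<in> positive_roots - {\<beta>}. dominates \<beta> \<alpha>}"
  have pos: "\<beta> \<in> positive_roots" and fin: "finite (?D \<beta>)" and card: "card (?D \<beta>) \<le> n"
    using \<beta> unfolding small_roots_def by auto
  have ss: "act s (act s v) = v" for v
    using s by (simp add: act_gen)
  have inj: "inj_on (act s) (?D (act s \<beta>))"
    by (rule inj_on_inverseI[of _ "act s"]) (rule ss)
  have sub: "act s ` ?D (act s \<beta>) \<subseteq> ?D \<beta>"
  proof (rule image_subsetI)
    fix \<alpha>
    assume "\<alpha> \<in> ?D (act s \<beta>)"
    then have \<alpha>: "\<alpha> \<in> positive_roots" "\<alpha> \<noteq> act s \<beta>" "dominates (act s \<beta>) \<alpha>"
      by blast+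
    then have "\<alpha> \<noteq> simple_root s" using dom by blast
    then have "act s \<alpha> \<in> positive_roots" using act_gen_positive s \<alpha> by blast
    moreover have "act s \<alpha> \<noteq> \<beta>" using ss \<alpha> by metis
    ultimately show "act s \<alpha> \<in> ?D \<beta>"
      using dominates_act_gen[OF s \<alpha>(3)] by simp
  qed
  have "finite (?D (act s \<beta>))"
    using finite_subset[OF sub fin] finite_image_iff[OF inj] by blast
  moreover have "card (?D (act s \<beta>)) \<le> n"
    using card_inj_on_le[OF inj sub fin] card by linarith
  ultimately show ?thesis
    unfolding small_roots_def using act_gen_positive s pos \<beta>(2) by blast
qed

lemma regular_shi_partition: "regular_partition (shi_partition n)"
  unfolding shi_partition_def
proof (rule regular_induced_partition)
  let ?\<X> = "pos_halfspace ` small_roots n \<union> neg_halfspace ` small_roots n"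
  let ?inv = "\<lambda>\<beta> w. negative (act (inv w) \<beta>)"
  have pos: "\<beta> \<in> positive_roots" if "\<beta> \<in> small_roots n" for \<beta>
    using that unfolding small_roots_def by blast
  \<comment> \<open>A half-space and its complement carry the same information, namely whether
    \<open>inv w\<close> makes \<beta> negative.\<close>
  have same_iff: "(\<forall>X\<in>?\<X>. x \<in> X \<longleftrightarrow> y \<in> X) \<longleftrightarrow> (\<forall>\<beta>\<in>small_roots n. ?inv \<beta> x \<longleftrightarrow> ?inv \<beta> y)"
    if "x \<in> carrier W" "y \<in> carrier W" for x y
    using that mem_pos_halfspace[OF _ pos] unfolding neg_halfspace_def by auto
  {
    fix x y
    assume xy: "x \<in> carrier W" "y \<in> carrier W" "\<forall>X\<in>?\<X>. x \<in> X \<longleftrightarrow> y \<in> X"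
    have "s \<in> left_descents x \<longleftrightarrow> s \<in> left_descents y" if "s \<in> S" for s
    proof -
      have "?inv (simple_root s) x \<longleftrightarrow> ?inv (simple_root s) y"
        using xy(3) simple_root_small[OF that, of n] unfolding same_iff[OF xy(1,2)] by (rule bspec)
      then show ?thesis
        using left_descent_iff_negative[OF xy(1), of s] left_descent_iff_negative[OF xy(2), of s]
        by blast
    qed
    then show "left_descents x = left_descents y"
      unfolding left_descents_def by blast
  next
    fix s x y X
    assume s: "s \<in> S" "x \<in> carrier W" "y \<in> carrier W"
      and same: "\<forall>X\<in>?\<X>. x \<in> X \<longleftrightarrow> y \<in> X"
      and len: "len (s \<otimes> x) = Suc (len x)" "len (s \<otimes> y) = Suc (len y)"
      and X: "X \<in> ?\<X>" "s \<otimes> x \<in> X"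
    have act_s: "act (inv (s \<otimes> w)) \<beta> = act (inv w) (act s \<beta>)" if "w \<in> carrier W" for w \<beta>
      using s that by (simp add: inv_mult_group act_mult)
    have not_neg: "\<not> ?inv (simple_root s) x" "\<not> ?inv (simple_root s) y"
      using left_descent_iff_negative[OF s(2), of s] left_descent_iff_negative[OF s(3), of s]
        not_left_descent[OF s(1,2)] not_left_descent[OF s(1,3)] s(1) len by blast+
    have "?inv \<beta> (s \<otimes> x) \<longleftrightarrow> ?inv \<beta> (s \<otimes> y)" if \<beta>: "\<beta> \<in> small_roots n" for \<beta>
    proof (cases "\<beta> = simple_root s")
      case True
      have "s \<in> left_descents (s \<otimes> x)" "s \<in> left_descents (s \<otimes> y)"
        using s len by (simp_all add: left_descents_iff)
      then show ?thesis
        unfolding True using s left_descent_iff_negative[of "s \<otimes> x" s]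
          left_descent_iff_negative[of "s \<otimes> y" s] by simp
    next
      case False
      show ?thesis
      proof (cases "dominates (act s \<beta>) (simple_root s)")
        case True
        \<comment> \<open>Contrapositive of domination: s is a left descent of neither x nor y, so
          neither inverse makes \<open>\<alpha>\<^sub>s\<close> negative, and hence neither makes
          s\<beta> negative. Both sides of the equivalence are false.\<close>
        then have "\<not> ?inv (act s \<beta>) w" if "w \<in> carrier W" "\<not> ?inv (simple_root s) w" for w
          using that unfolding dominates_def by blast
        then show ?thesis using not_neg s act_s by simp
      next
        case nd: False
        then have "act s \<beta> \<in> small_roots n"
          using small_root_act_gen s \<beta> False by blast
        then have "?inv (act s \<beta>) x \<longleftrightarrow> ?inv (act s \<beta>) y"
          using same unfolding same_iff[OF s(2,3)] by (rule bspec[rotated])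
        then show ?thesis using act_s s by simp
      qed
    qed
    then have *: "\<forall>\<beta>\<in>small_roots n. ?inv \<beta> (s \<otimes> x) \<longleftrightarrow> ?inv \<beta> (s \<otimes> y)"
      by (rule ballI)
    have "s \<otimes> x \<in> carrier W" "s \<otimes> y \<in> carrier W" using s by simp_all
    note same_iff[OF this, THEN iffD2, OF *]
    from bspec[OF this X(1)] X(2) show "s \<otimes> y \<in> X" by simp
  }
qed

end

theorem theorem3p11:
  fixes W :: "('a, 'b) monoid_scheme" and S :: "'a set"
  assumes "coxeter_system W S" and "finite S"
  shows
    "coxeter_system.regular_partition W S (coxeter_system.cone_type_partition W S) \<and>
     (\<forall>B. coxeter_system.garside_shadow W S B \<longrightarrow>
       coxeter_system.regular_partition W S (coxeter_system.garside_partition W S B)) \<and>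
     (\<forall>n::nat. coxeter_system.regular_partition W S (coxeter_system.shi_partition W S n))"
proof -
  interpret finite_coxeter_system W S
    using assms by (simp add: finite_coxeter_system_def finite_coxeter_system_axioms_def)
  show ?thesis
    using regular_cone_type_partition regular_garside_partition regular_shi_partition by blast
qed

end
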